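(* Let $\mathcal{W}=\bigcup_{n=1}^N\mathcal{W}_n$ with $\mathcal{W}_n=\{\omega:|\omega-\overline{\omega}_n|\le W_n/2\}$ pairwise disjoint, let $\alpha_0\ge0$, and let $h(t)=\sum_{n=1}^N\frac{W_n}{2\pi}e^{j\overline{\omega}_n t}\,\mathrm{sinc}\!\left(\frac{W_n}{2\pi}t\right)$ be the impulse response of the ideal filter $H(\omega)=1$ for $\omega\in\mathcal{W}$, $0$ otherwise. Let $q(z,t)$, with $q(z,\cdot)\in L^2(\mathbb{R})$, be a bounded signal propagating according to $$\frac{\partial}{\partial z}q(z,t)=-\frac12 a(t)*q(z,t)-j\frac{\beta_2}{2}\frac{\partial^2}{\partial t^2}q(z,t)+j\gamma|q(z,t)|^2q(z,t),$$ where $a(t)$ is the inverse Fourier transform of the brick-walls attenuation profile $\alpha(\omega)=\alpha_0$ for $\omega\in\mathcal{W}$, $\alpha(\omega)=\infty$ otherwise. Then the signal energy $$E(z)=\int_{-\infty}^{\infty}|h(t)*q(z,t)|^2\,dt$$ satisfies $E(z)=E_{\mathcal{W}}(0)e^{-\alpha_0 z}$ for $z>0$.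
   Context: $z$ is distance, $t$ time; $*$ denotes convolution in $t$; $\mathrm{sinc}(x)=\sin(\pi x)/(\pi x)$; $\beta_2,\gamma$ are real constants; "bounded" means $|q(z,t)|\le q_{\max}$. $Q(z,\omega)=\int q(z,t)e^{-j\omega t}dt$ and $E_{\mathcal{W}}(0)=\frac{1}{2\pi}\int_{\mathcal{W}}|Q(0,\omega)|^2d\omega$. The infinite out-of-band attenuation acts as an ideal brick-wall band-pass filter onto $\mathcal{W}$ applied continuously along $z$ (the limiting case of infinitely large attenuation outside $\mathcal{W}$). *)

theory Defs
  imports "HOL-Analysis.Analysis"
begin

definition sinc :: "real \<Rightarrow> real" where
  "sinc x = (if x = 0 then 1 else sin (pi * x) / (pi * x))"

definition conv :: "(real \<Rightarrow> complex) \<Rightarrow> (real \<Rightarrow> complex) \<Rightarrow> real \<Rightarrow> complex" where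
  "conv f g t = (LINT s|lborel. f s * g (t - s))"

definition sq_int :: "(real \<Rightarrow> complex) \<Rightarrow> bool" where
  "sq_int f \<longleftrightarrow> f \<in> borel_measurable lborel \<and> integrable lborel (\<lambda>t. (cmod (f t))\<^sup>2)"

definition L2dist2 :: "(real \<Rightarrow> complex) \<Rightarrow> (real \<Rightarrow> complex) \<Rightarrow> real" where
  "L2dist2 f g = (LINT t|lborel. (cmod (f t - g t))\<^sup>2)"

text \<open>Q is the (L2 / Plancherel) Fourier transform of f, Q(w) = int f(t) e^{-jwt} dt,
  the integral understood as the L2-limit of truncated integrals.\<close>
definition is_FT :: "(real \<Rightarrow> complex) \<Rightarrow> (real \<Rightarrow> complex) \<Rightarrow> bool" where
  "is_FT f Q \<longleftrightarrow> sq_int Q \<and>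
     ((\<lambda>R. L2dist2 Q (\<lambda>w. set_lebesgue_integral lborel {-R..R}
                (\<lambda>t. f t * exp (- \<i> * complex_of_real (w * t))))) \<longlongrightarrow> 0) at_top"

definition filt_h :: "nat \<Rightarrow> (nat \<Rightarrow> real) \<Rightarrow> (nat \<Rightarrow> real) \<Rightarrow> real \<Rightarrow> complex" where
  "filt_h N wc W t = (\<Sum>n\<in>{1..N}. complex_of_real (W n / (2 * pi))
       * exp (\<i> * complex_of_real (wc n * t)) * complex_of_real (sinc (W n / (2 * pi) * t)))"

definition band :: "nat \<Rightarrow> (nat \<Rightarrow> real) \<Rightarrow> (nat \<Rightarrow> real) \<Rightarrow> real set" where
  "band N wc W = (\<Union>n\<in>{1..N}. {w. \<bar>w - wc n\<bar> \<le> W n / 2})"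

end

theory Submission
  imports Defs "HOL-Probability.Sinc_Integral"
begin

text \<open>
  Convolution with the filter response \<open>h\<close> is an orthogonal projection of \<open>L\<^sup>2\<close>: it is
  self-adjoint because \<open>h\<close> is Hermitian, and idempotent because \<open>h * h = h\<close>, which comes down
  to the limits of the sine integral. For integrable \<open>f\<close> this already gives
  \<open>\<parallel>h * f\<parallel>\<^sup>2 = \<langle>f, h * f\<rangle> = 1 / (2 * pi)\<close> times the integral of the squared spectrum over the band,
  so no general Plancherel theorem is needed; truncation extends everything to \<open>L\<^sup>2\<close>.
  Applied to difference quotients it yields Bernstein's inequality, so the time derivatives of the
  band-limited signal are square integrable.
  Since the projection can be moved onto the signal, the energy has derivative
  \<open>2 Re \<langle>q, g\<rangle>\<close>, where \<open>g\<close> is the unfiltered right-hand side of the propagation equation; the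
  dispersive and the nonlinear term contribute only to the imaginary part, which leaves
  \<open>E' = - \<alpha>0 E\<close>.
\<close>

subsection \<open>Square-integrable functions\<close>

text \<open>Every interchange therefore needs one integrable factor, and what is carried to the
  limit is the fact that the filter is a contraction. The infinite attenuation enters in its
  limiting form: at positive distance the filter fixes the signal, and the mean-square derivative in
  \<open>z\<close> is the filtered right-hand side. At distance 0 the signal may still have energy
  outside the band; only the filtered signal is assumed continuous there, which is why the initial
  value is the energy inside the band. The hypotheses say nothing about the size of
  \<open>qtt\<close>. A Bochner integral of a non-integrable function is 0 by default, so square
  integrability must be secured before an inner product with \<open>qtt\<close> means anything; this
  is the reason for the detour through Bernstein's inequality.\<close>

definition l2norm :: "(real \<Rightarrow> complex) \<Rightarrow> real" where
  "l2norm f = sqrt (LINT t|lborel. (cmod (f t))\<^sup>2)"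

definition l2inner :: "(real \<Rightarrow> complex) \<Rightarrow> (real \<Rightarrow> complex) \<Rightarrow> complex" where
  "l2inner f g = (LINT t|lborel. f t * cnj (g t))"

lemma borel_measurable_sq_int: "sq_int f \<Longrightarrow> f \<in> borel_measurable borel"
  by (simp add: sq_int_def)

lemma sq_int_boundI:
  assumes "f \<in> borel_measurable borel" "integrable lborel g" "\<And>t. (cmod (f t))\<^sup>2 \<le> g t"
  shows "sq_int f"
  unfolding sq_int_def
proof (intro conjI Bochner_Integration.integrable_bound[OF assms(2)] AE_I2)
  have [measurable]: "f \<in> borel_measurable borel" by fact
  show "f \<in> borel_measurable lborel" "(\<lambda>t. (cmod (f t))\<^sup>2) \<in> borel_measurable lborel"
    by measurable
  show "norm ((cmod (f t))\<^sup>2) \<le> norm (g t)" for t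
    using assms(3)[of t] by simp
qed

lemma sq_int_cmult: "sq_int f \<Longrightarrow> sq_int (\<lambda>t. c * f t)"
  by (auto simp: sq_int_def norm_mult power_mult_distrib)

lemma sq_int_cnj: "sq_int f \<Longrightarrow> sq_int (\<lambda>t. cnj (f t))"
  by (auto simp: sq_int_def intro: borel_measurable_continuous_on[OF continuous_on_cnj[OF continuous_on_id]])

lemma sq_int_add:
  assumes "sq_int f" "sq_int g"
  shows "sq_int (\<lambda>t. f t + g t)"
proof (rule sq_int_boundI)
  show "(\<lambda>t. f t + g t) \<in> borel_measurable borel"
    using assms by (auto simp: sq_int_def)
  show "integrable lborel (\<lambda>t. 2 * (cmod (f t))\<^sup>2 + 2 * (cmod (g t))\<^sup>2)"
    using assms by (auto simp: sq_int_def)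
  show "(cmod (f t + g t))\<^sup>2 \<le> 2 * (cmod (f t))\<^sup>2 + 2 * (cmod (g t))\<^sup>2" for t
  proof -
    have "(cmod (f t + g t))\<^sup>2 \<le> (cmod (f t) + cmod (g t))\<^sup>2"
      by (intro power_mono norm_triangle_ineq) auto
    also have "\<dots> \<le> 2 * (cmod (f t))\<^sup>2 + 2 * (cmod (g t))\<^sup>2"
      using sum_squares_bound[of "cmod (f t)" "cmod (g t)"] by (simp add: power2_sum)
    finally show ?thesis .
  qed
qed

lemma sq_int_diff: "sq_int f \<Longrightarrow> sq_int g \<Longrightarrow> sq_int (\<lambda>t. f t - g t)"
  using sq_int_add[of f "\<lambda>t. -1 * g t"] sq_int_cmult[of g "-1"] by simp

lemma sq_int_affine: "sq_int f \<Longrightarrow> c \<noteq> 0 \<Longrightarrow> sq_int (\<lambda>t. f (a + c * t))"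
  using lborel_integrable_real_affine[of "\<lambda>t. (cmod (f t))\<^sup>2" c a]
  by (auto simp: sq_int_def)

lemma sq_int_shift: "sq_int f \<Longrightarrow> sq_int (\<lambda>t. f (t + a))"
  using sq_int_affine[of f 1 a] by (simp add: add.commute)

lemma sq_int_shift_minus: "sq_int f \<Longrightarrow> sq_int (\<lambda>t. f (t - a))"
  using sq_int_shift[of f "-a"] by simp

lemma sq_int_reflect: "sq_int f \<Longrightarrow> sq_int (\<lambda>t. f (a - t))"
  using sq_int_affine[of f "-1" a] by simp

lemma sq_int_integrable_norm_mult:
  assumes "sq_int f" "sq_int g"
  shows "integrable lborel (\<lambda>t. cmod (f t) * cmod (g t))"
proof (rule Bochner_Integration.integrable_bound)
  show "integrable lborel (\<lambda>t. (cmod (f t))\<^sup>2 + (cmod (g t))\<^sup>2)"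
    using assms by (auto simp: sq_int_def)
  show "(\<lambda>t. cmod (f t) * cmod (g t)) \<in> borel_measurable lborel"
    using assms by (auto simp: sq_int_def)
  have "norm (cmod (f t) * cmod (g t)) \<le> norm ((cmod (f t))\<^sup>2 + (cmod (g t))\<^sup>2)" for t
  proof -
    have "2 * (cmod (f t) * cmod (g t)) \<le> (cmod (f t))\<^sup>2 + (cmod (g t))\<^sup>2"
      using sum_squares_bound[of "cmod (f t)" "cmod (g t)"] by simp
    moreover have "0 \<le> cmod (f t) * cmod (g t)" by simp
    ultimately show ?thesis unfolding real_norm_def by linarith
  qed
  then show "AE t in lborel. norm (cmod (f t) * cmod (g t)) \<le> norm ((cmod (f t))\<^sup>2 + (cmod (g t))\<^sup>2)"
    by simp
qed

lemma sq_int_integrable_mult: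
  assumes "sq_int f" "sq_int g"
  shows "integrable lborel (\<lambda>t. f t * g t)"
  by (rule Bochner_Integration.integrable_bound[OF sq_int_integrable_norm_mult[OF assms]])
     (use assms in \<open>auto simp: sq_int_def norm_mult\<close>)

lemma l2norm_nonneg [simp]: "0 \<le> l2norm f"
  by (simp add: l2norm_def)

lemma l2norm_power2: "(l2norm f)\<^sup>2 = (LINT t|lborel. (cmod (f t))\<^sup>2)"
  by (simp add: l2norm_def)

lemma L2dist2_eq: "L2dist2 f g = (l2norm (\<lambda>t. f t - g t))\<^sup>2"
  by (simp add: l2norm_power2 L2dist2_def)

lemma l2inner_self: "sq_int f \<Longrightarrow> l2inner f f = (l2norm f)\<^sup>2"
  unfolding l2inner_def l2norm_power2 of_real_power[symmetric]
  by (subst complex_norm_square[symmetric]) (simp add: integral_complex_of_real[symmetric])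

text \<open>The integral of \<open>(x * |f| - |g|)^2\<close> is nonnegative for every real
  \<open>x\<close>. If one of the norms vanishes, a suitable \<open>x\<close> in this quadratic
  inequality shows that the mixed term is not positive.\<close>

lemma l2_Cauchy_Schwarz_norm:
  assumes "sq_int f" "sq_int g"
  shows "(LINT t|lborel. cmod (f t) * cmod (g t)) \<le> l2norm f * l2norm g"
proof -
  define X where "X = (LINT t|lborel. cmod (f t) * cmod (g t))"
  have X: "2 * x * X \<le> x\<^sup>2 * (l2norm f)\<^sup>2 + (l2norm g)\<^sup>2" for x :: real
  proof -
    have "2 * x * X = (LINT t|lborel. 2 * x * (cmod (f t) * cmod (g t)))"
      by (simp add: X_def)
    also have "\<dots> \<le> (LINT t|lborel. x\<^sup>2 * (cmod (f t))\<^sup>2 + (cmod (g t))\<^sup>2)"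
    proof (rule integral_mono)
      show "2 * x * (cmod (f t) * cmod (g t)) \<le> x\<^sup>2 * (cmod (f t))\<^sup>2 + (cmod (g t))\<^sup>2" for t
        using sum_squares_bound[of "x * cmod (f t)" "cmod (g t)"]
        by (simp add: power_mult_distrib mult_ac)
    qed (use assms sq_int_integrable_norm_mult[OF assms] in \<open>auto simp: sq_int_def\<close>)
    also have "\<dots> = x\<^sup>2 * (l2norm f)\<^sup>2 + (l2norm g)\<^sup>2"
      using assms by (simp add: l2norm_power2 sq_int_def)
    finally show ?thesis .
  qed
  show ?thesis
  proof (cases "l2norm f = 0")
    case True
    have "X \<le> 0"
    proof (rule ccontr)
      assume "\<not> X \<le> 0"
      then show False
        using X[of "((l2norm g)\<^sup>2 + 1) / X"] True zero_le_power2[of "l2norm g"] by simp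
    qed
    then show ?thesis using True by (simp add: X_def)
  next
    case False
    then have p: "l2norm f > 0" using l2norm_nonneg[of f] by linarith
    \<comment> \<open>The value \<open>x = l2norm g / l2norm f\<close> balances the two terms on the
      right of \<open>X\<close>. What remains is to cancel one factor \<open>l2norm g\<close>, so a
      vanishing \<open>l2norm g\<close> needs its own argument.\<close>
    have "X * l2norm g \<le> l2norm f * (l2norm g)\<^sup>2 \<or> l2norm g = 0" 
      using X[of "l2norm g / l2norm f"] p by (simp add: field_simps power2_eq_square)
    moreover have "X \<le> 0" if "l2norm g = 0"
    proof (rule ccontr)
      assume "\<not> X \<le> 0"
      then show False
        using X[of "X / (l2norm f)\<^sup>2"] that p by (simp add: field_simps power2_eq_square)
    qed
    ultimately show ?thesis
      using p l2norm_nonneg[of g] unfolding X_def[symmetric] power2_eq_square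
      by (metis mult.assoc mult_le_cancel_right mult_zero_right not_less order_le_less)
  qed
qed

lemma l2_Cauchy_Schwarz:
  assumes "sq_int f" "sq_int g"
  shows "cmod (LINT t|lborel. f t * g t) \<le> l2norm f * l2norm g"
proof -
  have "cmod (LINT t|lborel. f t * g t) \<le> (LINT t|lborel. cmod (f t * g t))"
    by (rule integral_norm_bound)
  also have "\<dots> \<le> l2norm f * l2norm g"
    using l2_Cauchy_Schwarz_norm[OF assms] by (simp add: norm_mult)
  finally show ?thesis .
qed

lemma l2norm_cnj: "l2norm (\<lambda>t. cnj (f t)) = l2norm f"
  by (simp add: l2norm_def)

lemma l2norm_cmult: "l2norm (\<lambda>t. c * f t) = cmod c * l2norm f"
  by (simp add: l2norm_def norm_mult power_mult_distrib real_sqrt_mult)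

lemma l2norm_shift: "l2norm (\<lambda>t. f (t + a)) = l2norm f"
  using lborel_integral_real_affine[of 1 "\<lambda>t. (cmod (f t))\<^sup>2" a]
  by (simp add: l2norm_def add.commute)

lemma l2norm_reflect: "l2norm (\<lambda>t. f (a - t)) = l2norm f"
  using lborel_integral_real_affine[of "-1" "\<lambda>t. (cmod (f t))\<^sup>2" a]
  by (simp add: l2norm_def)

lemma norm_l2inner_le:
  assumes "sq_int f" "sq_int g"
  shows "cmod (l2inner f g) \<le> l2norm f * l2norm g"
  using l2_Cauchy_Schwarz[OF assms(1) sq_int_cnj[OF assms(2)]] by (simp add: l2inner_def l2norm_cnj)

lemma l2inner_integrable:
  "sq_int f \<Longrightarrow> sq_int g \<Longrightarrow> integrable lborel (\<lambda>t. f t * cnj (g t))"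
  by (intro sq_int_integrable_mult sq_int_cnj)

lemma l2inner_diff_left:
  "sq_int f \<Longrightarrow> sq_int g \<Longrightarrow> sq_int k \<Longrightarrow> l2inner (\<lambda>t. f t - g t) k = l2inner f k - l2inner g k"
  unfolding l2inner_def
  by (subst Bochner_Integration.integral_diff[symmetric]) (auto intro: l2inner_integrable simp: algebra_simps)

lemma l2norm_power2_add:
  assumes "sq_int f" "sq_int g"
  shows "(l2norm (\<lambda>t. f t + g t))\<^sup>2 = (l2norm f)\<^sup>2 + 2 * Re (l2inner f g) + (l2norm g)\<^sup>2"
proof -
  have i: "integrable lborel (\<lambda>t. Re (f t * cnj (g t)))"
    using l2inner_integrable[OF assms] by (rule integrable_Re)
  have "(l2norm (\<lambda>t. f t + g t))\<^sup>2
      = (LINT t|lborel. (cmod (f t))\<^sup>2 + 2 * Re (f t * cnj (g t)) + (cmod (g t))\<^sup>2)"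
    unfolding l2norm_power2
    by (intro Bochner_Integration.integral_cong refl) (simp add: cmod_power2, simp add: power2_eq_square algebra_simps)
  also have "\<dots> = (l2norm f)\<^sup>2 + 2 * Re (l2inner f g) + (l2norm g)\<^sup>2"
    using assms i integral_Re[OF l2inner_integrable[OF assms]]
    by (simp add: l2norm_power2 sq_int_def l2inner_def del: integral_Re times_complex.simps complex_cnj)
  finally show ?thesis .
qed

lemma l2norm_triangle:
  assumes "sq_int f" "sq_int g"
  shows "l2norm (\<lambda>t. f t + g t) \<le> l2norm f + l2norm g"
proof (rule power2_le_imp_le)
  have "Re (l2inner f g) \<le> l2norm f * l2norm g"
    using norm_l2inner_le[OF assms] complex_Re_le_cmod order_trans by blast
  then show "(l2norm (\<lambda>t. f t + g t))\<^sup>2 \<le> (l2norm f + l2norm g)\<^sup>2"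
    by (simp add: l2norm_power2_add[OF assms] power2_sum)
qed simp

lemma l2norm_minus_commute: "l2norm (\<lambda>t. f t - g t) = l2norm (\<lambda>t. g t - f t)"
  by (simp add: l2norm_def norm_minus_commute)

lemma l2norm_diff_triangle:
  assumes "sq_int f" "sq_int g"
  shows "\<bar>l2norm f - l2norm g\<bar> \<le> l2norm (\<lambda>t. f t - g t)"
  using l2norm_triangle[OF sq_int_diff[OF assms] assms(2)]
    l2norm_triangle[OF sq_int_diff[OF assms(2,1)] assms(1)] l2norm_minus_commute[of f g]
  by simp

lemma tendsto_l2norm:
  assumes "((\<lambda>x. l2norm (\<lambda>t. F x t - f t)) \<longlongrightarrow> 0) A" "eventually (\<lambda>x. sq_int (F x)) A" "sq_int f"
  shows "((\<lambda>x. l2norm (F x)) \<longlongrightarrow> l2norm f) A"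
proof (rule Lim_transform)
  show "((\<lambda>x. l2norm f) \<longlongrightarrow> l2norm f) A" by simp
  show "((\<lambda>x. l2norm (F x) - l2norm f) \<longlongrightarrow> 0) A"
  proof (rule Lim_null_comparison[OF _ assms(1)])
    show "eventually (\<lambda>x. norm (l2norm (F x) - l2norm f) \<le> l2norm (\<lambda>t. F x t - f t)) A"
      using assms(2)
      by eventually_elim (metis assms(3) l2norm_diff_triangle real_norm_def)
  qed
qed

text \<open>Fatou's lemma. It serves wherever a limit is known only pointwise: filtered signals,
  time derivatives as limits of difference quotients, and the spectrum as a limit of its
  truncations.\<close>

lemma sq_int_LIMSEQ:
  assumes sq: "\<And>n. sq_int (F n)" and lim: "\<And>t. (\<lambda>n. F n t) \<longlonglongrightarrow> f t"
    and bd: "\<And>n. l2norm (F n) \<le> C"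
  shows "sq_int f" "l2norm f \<le> C"
proof -
  have [measurable]: "F n \<in> borel_measurable borel" for n
    using sq by (rule borel_measurable_sq_int)
  have fm[measurable]: "f \<in> borel_measurable borel"
    by (rule borel_measurable_LIMSEQ_metric[OF _ lim]) measurable
  have C: "0 \<le> C" using bd[of 0] l2norm_nonneg order_trans by blast
  have "(\<integral>\<^sup>+t. ennreal ((cmod (f t))\<^sup>2) \<partial>lborel)
      = (\<integral>\<^sup>+t. liminf (\<lambda>n. ennreal ((cmod (F n t))\<^sup>2)) \<partial>lborel)"
  proof (rule nn_integral_cong)
    fix t
    have "(\<lambda>n. ennreal ((cmod (F n t))\<^sup>2)) \<longlonglongrightarrow> ennreal ((cmod (f t))\<^sup>2)"
      by (intro tendsto_intros tendsto_ennrealI lim)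
    from lim_imp_Liminf[OF sequentially_bot this]
    show "ennreal ((cmod (f t))\<^sup>2) = liminf (\<lambda>n. ennreal ((cmod (F n t))\<^sup>2))"
      by simp
  qed
  also have "\<dots> \<le> liminf (\<lambda>n. \<integral>\<^sup>+t. ennreal ((cmod (F n t))\<^sup>2) \<partial>lborel)"
    by (rule nn_integral_liminf) measurable
  also have "\<dots> \<le> liminf (\<lambda>n. ennreal (C\<^sup>2))"
  proof (intro Liminf_mono always_eventually allI)
    fix n
    have "(\<integral>\<^sup>+t. ennreal ((cmod (F n t))\<^sup>2) \<partial>lborel) = ennreal ((l2norm (F n))\<^sup>2)"
      using sq[of n] unfolding l2norm_power2 sq_int_def by (intro nn_integral_eq_integral) auto
    also have "\<dots> \<le> ennreal (C\<^sup>2)"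
      using bd[of n] by (intro ennreal_leI power_mono) auto
    finally show "(\<integral>\<^sup>+t. ennreal ((cmod (F n t))\<^sup>2) \<partial>lborel) \<le> ennreal (C\<^sup>2)" .
  qed
  finally have le: "(\<integral>\<^sup>+t. ennreal ((cmod (f t))\<^sup>2) \<partial>lborel) \<le> ennreal (C\<^sup>2)"
    by (simp add: Liminf_const)
  have int: "integrable lborel (\<lambda>t. (cmod (f t))\<^sup>2)"
    unfolding integrable_iff_bounded
    using order.strict_trans1[OF le] by auto
  then show "sq_int f" using fm by (simp add: sq_int_def)
  have "ennreal ((l2norm f)\<^sup>2) \<le> ennreal (C\<^sup>2)"
    using le nn_integral_eq_integral[OF int] by (simp add: l2norm_power2)
  then show "l2norm f \<le> C"
    using C by (intro power2_le_imp_le[OF _ C]) simp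
qed

section \<open>Truncation to bounded intervals\<close>

definition truncate :: "real \<Rightarrow> (real \<Rightarrow> complex) \<Rightarrow> real \<Rightarrow> complex" where
  "truncate R f t = indicator {-R..R} t * f t"

lemma sq_int_indicator_mult:
  assumes "sq_int f" "A \<in> sets borel"
  shows "sq_int (\<lambda>t. indicator A t * f t)" "l2norm (\<lambda>t. indicator A t * f t) \<le> l2norm f"
proof -
  show sq: "sq_int (\<lambda>t. indicator A t * f t)"
    by (rule sq_int_boundI[of _ "\<lambda>t. (cmod (f t))\<^sup>2"])
       (use assms in \<open>auto simp: sq_int_def split: split_indicator\<close>)
  have "(l2norm (\<lambda>t. indicator A t * f t))\<^sup>2 \<le> (l2norm f)\<^sup>2"
    unfolding l2norm_power2
    by (rule integral_mono) (use sq assms in \<open>auto simp: sq_int_def split: split_indicator\<close>)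
  then show "l2norm (\<lambda>t. indicator A t * f t) \<le> l2norm f"
    by (rule power2_le_imp_le) simp
qed

lemma sq_int_truncate: "sq_int f \<Longrightarrow> sq_int (truncate R f)"
  and l2norm_truncate_le: "sq_int f \<Longrightarrow> l2norm (truncate R f) \<le> l2norm f"
  using sq_int_indicator_mult[of f "{-R..R}"] by (auto simp: truncate_def[abs_def])

text \<open>A truncation is the product of two square-integrable functions, one of them the
  indicator of a bounded interval. This is the bridge from square-integrable to integrable
  signals.\<close>

lemma integrable_truncate:
  assumes "sq_int f" shows "integrable lborel (truncate R f)"
proof -
  have "sq_int (indicator {-R..R})"
    by (rule sq_int_boundI[of _ "indicator {-R..R}"]) (auto split: split_indicator simp: emeasure_lborel_Icc_eq)
  from sq_int_integrable_mult[OF this assms] show ?thesis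
    by (simp add: truncate_def[abs_def])
qed

lemma l2norm_truncate_tendsto:
  assumes "sq_int f"
  shows "(\<lambda>n. l2norm (\<lambda>t. f t - truncate (real n) f t)) \<longlonglongrightarrow> 0"
proof -
  have [measurable]: "f \<in> borel_measurable borel" using assms by (rule borel_measurable_sq_int)
  have "(\<lambda>n. LINT t|lborel. (cmod (f t - truncate (real n) f t))\<^sup>2) \<longlonglongrightarrow> integral\<^sup>L lborel (\<lambda>t::real. 0::real)"
  proof (rule integral_dominated_convergence[where w="\<lambda>t. (cmod (f t))\<^sup>2"])
    show "integrable lborel (\<lambda>t. (cmod (f t))\<^sup>2)" using assms by (simp add: sq_int_def)
    show "AE t in lborel. (\<lambda>n. (cmod (f t - truncate (real n) f t))\<^sup>2) \<longlonglongrightarrow> 0"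
    proof (rule AE_I2)
      fix t :: real
      obtain m where "\<bar>t\<bar> \<le> real m" using real_arch_simple by blast
      then have "eventually (\<lambda>n. (cmod (f t - truncate (real n) f t))\<^sup>2 = 0) sequentially"
        unfolding eventually_sequentially
        by (intro exI[of _ m]) (auto simp: truncate_def abs_le_iff)
      then show "(\<lambda>n. (cmod (f t - truncate (real n) f t))\<^sup>2) \<longlonglongrightarrow> 0"
        by (rule tendsto_eventually)
    qed
  qed (auto simp: truncate_def split: split_indicator)
  then have "(\<lambda>n. sqrt (LINT t|lborel. (cmod (f t - truncate (real n) f t))\<^sup>2)) \<longlonglongrightarrow> sqrt 0"
    by (intro tendsto_real_sqrt) simp
  then show ?thesis by (simp add: l2norm_def)
qed

subsection \<open>Convolution with a band kernel\<close>

lemma borel_measurable_cis [measurable]: "cis \<in> borel_measurable borel"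
  by (intro borel_measurable_continuous_onI continuous_on_cis continuous_on_id)

lemma borel_measurable_cnj [measurable]: "cnj \<in> borel_measurable borel"
  by (intro borel_measurable_continuous_onI continuous_on_cnj continuous_on_id)

text \<open>Justifies the interchanges of a time integral with a frequency integral, where
  \<open>\<phi>\<close> is always a phase of modulus 1.\<close>

lemma integrable_pair_mult_bounded:
  fixes f g :: "real \<Rightarrow> complex" and \<phi> :: "real \<Rightarrow> real \<Rightarrow> complex"
  assumes f: "integrable lborel f" and g: "integrable lborel g"
    and [measurable]: "(\<lambda>(x, y). \<phi> x y) \<in> borel_measurable (borel \<Otimes>\<^sub>M borel)"
    and \<phi>: "\<And>x y. cmod (\<phi> x y) \<le> 1"
  shows "integrable (lborel \<Otimes>\<^sub>M lborel) (\<lambda>(x, y). f x * g y * \<phi> x y)"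
proof (rule lborel_pair.Fubini_integrable)
  have [measurable]: "f \<in> borel_measurable borel" "g \<in> borel_measurable borel"
    using f g by auto
  show "(\<lambda>(x, y). f x * g y * \<phi> x y) \<in> borel_measurable (lborel \<Otimes>\<^sub>M lborel)"
    by measurable
  have le: "cmod (f x * g y * \<phi> x y) \<le> cmod (f x) * cmod (g y)" for x y
    unfolding norm_mult using \<phi>[of x y] by (intro mult_left_le) auto
  have inty: "integrable lborel (\<lambda>y. f x * g y * \<phi> x y)" for x
  proof (rule Bochner_Integration.integrable_bound)
    show "integrable lborel (\<lambda>y. f x * g y)" using g by simp
  qed (use le in \<open>auto simp: norm_mult\<close>)
  then show "AE x in lborel. integrable lborel (\<lambda>y. case (x, y) of (x, y) \<Rightarrow> f x * g y * \<phi> x y)"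
    by simp
  show "integrable lborel (\<lambda>x. LINT y|lborel. norm (case (x, y) of (x, y) \<Rightarrow> f x * g y * \<phi> x y))"
  proof (rule Bochner_Integration.integrable_bound)
    show "integrable lborel (\<lambda>x. f x * (LINT y|lborel. cmod (g y)))" using f by simp
    have "(LINT y|lborel. cmod (f x * g y * \<phi> x y)) \<le> cmod (f x) * (LINT y|lborel. cmod (g y))" for x
    proof -
      have "(LINT y|lborel. cmod (f x * g y * \<phi> x y)) \<le> (LINT y|lborel. cmod (f x) * cmod (g y))"
        by (rule integral_mono) (use inty g le in auto)
      then show ?thesis by simp
    qed
    then show "AE x in lborel. norm (LINT y|lborel. norm (case (x, y) of (x, y) \<Rightarrow> f x * g y * \<phi> x y))
        \<le> norm (f x * (LINT y|lborel. cmod (g y)))"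
      by (auto simp: norm_mult)
  qed measurable
qed

lemma conv_commute: "conv f g t = (LINT s|lborel. f (t - s) * g s)"
  using lborel_integral_real_affine[of "-1" "\<lambda>s. f (t - s) * g s" t] by (simp add: conv_def)

lemma conv_shift: "conv f (\<lambda>t. g (t + a)) t = conv f g (t + a)"
  by (simp add: conv_def algebra_simps)

lemma conv_cmult: "conv f (\<lambda>t. c * g t) t = c * conv f g t"
proof -
  have "conv f (\<lambda>t. c * g t) t = (LINT s|lborel. c * (f s * g (t - s)))"
    by (simp add: conv_def mult_ac)
  then show ?thesis by (simp add: conv_def)
qed

lemma conv_diff:
  "sq_int f \<Longrightarrow> sq_int g \<Longrightarrow> sq_int h \<Longrightarrow> conv f (\<lambda>t. g t - h t) t = conv f g t - conv f h t"
  unfolding conv_def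
  by (subst Bochner_Integration.integral_diff[symmetric])
     (auto intro!: sq_int_integrable_mult sq_int_reflect simp: algebra_simps)

text \<open>The bound holds at every \<open>t\<close>, so mean-square convergence of one factor
  gives pointwise convergence of the convolution.\<close>

lemma norm_conv_le:
  "sq_int f \<Longrightarrow> sq_int g \<Longrightarrow> cmod (conv f g t) \<le> l2norm f * l2norm g"
  unfolding conv_def using l2_Cauchy_Schwarz[of f "\<lambda>s. g (t - s)"]
  by (simp add: sq_int_reflect l2norm_reflect)

lemma borel_measurable_conv:
  assumes [measurable]: "f \<in> borel_measurable borel" "g \<in> borel_measurable borel"
  shows "conv f g \<in> borel_measurable borel"
  unfolding conv_def[abs_def] by measurable

text \<open>An absolutely convergent integral, hence meaningful only for integrable \<open>f\<close>
  (otherwise the value is 0 by default). The transform in \<open>is_FT\<close> is the mean-square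
  limit of \<open>ft\<close> along truncations.\<close>

definition ft :: "(real \<Rightarrow> complex) \<Rightarrow> real \<Rightarrow> complex" where
  "ft f w = (LINT t|lborel. f t * cis (- (w * t)))"

lemma borel_measurable_ft:
  assumes [measurable]: "f \<in> borel_measurable borel"
  shows "ft f \<in> borel_measurable borel"
  unfolding ft_def[abs_def] by measurable

lemma integrable_mult_cis:
  assumes "integrable lborel f"
  shows "integrable lborel (\<lambda>t. f t * cis (c * t))"
proof (rule Bochner_Integration.integrable_bound[OF assms])
  have [measurable]: "f \<in> borel_measurable borel" using assms by auto
  show "(\<lambda>t. f t * cis (c * t)) \<in> borel_measurable lborel" by measurable
qed (simp add: norm_mult)

lemma norm_ft_le: "cmod (ft f w) \<le> (LINT t|lborel. cmod (f t))"
  using integral_norm_bound[of lborel "\<lambda>t. f t * cis (- (w * t))"]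
  by (simp add: ft_def norm_mult)

text \<open>Abstract because two instances occur: the filter of the theorem, and the symmetric
  intervals \<open>[-n, n]\<close> that exhaust the frequency axis in the bound for
  \<open>ft\<close>. \<open>M\<close> becomes the constant in Bernstein's inequality. Idempotence is
  a locale assumption; the instances obtain it from the sine integral.\<close>

locale band_kernel =
  fixes A :: "real set" and M :: real and k :: "real \<Rightarrow> complex"
  assumes band_measurable: "A \<in> sets borel"
    and bound_nonneg: "0 \<le> M"
    and band_bounded: "\<And>w. w \<in> A \<Longrightarrow> \<bar>w\<bar> \<le> M"
    and kernel_eq: "\<And>t. k t = 1 / (2 * pi) * (LINT w|lborel. indicator A w * cis (w * t))"
    and sq_int_kernel: "sq_int k"
    and kernel_idem: "\<And>t. conv k k t = k t"
begin

lemma borel_measurable_kernel [measurable]: "k \<in> borel_measurable borel"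
  using sq_int_kernel by (rule borel_measurable_sq_int)

lemma integrable_band: "integrable lborel (indicator A :: real \<Rightarrow> complex)"
proof -
  have "A \<subseteq> {-M..M}" using band_bounded by (auto simp: abs_le_iff minus_le_iff)
  then have "emeasure lborel A \<le> emeasure lborel {-M..M}"
    using band_measurable by (intro emeasure_mono) auto
  also have "\<dots> < \<infinity>" by (simp add: emeasure_lborel_Icc_eq)
  finally show ?thesis
    using integrable_indicator[of A lborel "1::complex"] band_measurable
    by (simp add: scaleR_conv_of_real of_real_indicator)
qed

lemma cnj_kernel: "cnj (k t) = k (- t)"
proof -
  have "cnj (LINT w|lborel. indicator A w * cis (w * t)) = (LINT w|lborel. indicator A w * cis (w * - t))"
    by (subst Bochner_Integration.integral_cnj[symmetric])
       (auto intro!: Bochner_Integration.integral_cong simp: cis_cnj split: split_indicator)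
  then show ?thesis by (simp add: kernel_eq)
qed

lemma norm_kernel_le: "cmod (k t) \<le> 1 / (2 * pi) * (LINT w|lborel. cmod (indicator A w))"
  using integral_norm_bound[of lborel "\<lambda>w. indicator A w * cis (w * t)"]
  by (simp add: kernel_eq norm_mult norm_divide divide_right_mono)

text \<open>Young's inequality for an integrable and a square-integrable factor:
  \<open>|k * f|^2\<close> is at most the norm of \<open>f\<close> in \<open>L1\<close> times the
  convolution of \<open>|f|\<close> with \<open>|k|^2\<close>, and that is integrable by
  Fubini.\<close>

lemma conv_kernel_sq_int_L1:
  assumes f: "integrable lborel f"
  shows "sq_int (conv k f)"
proof (rule sq_int_boundI)
  have [measurable]: "f \<in> borel_measurable borel" using f by auto
  define B where "B = 1 / (2 * pi) * (LINT w|lborel. cmod (indicator A w))"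
  define G where "G t = (LINT s|lborel. cmod (f s) * (cmod (k (t - s)))\<^sup>2)" for t
  show "conv k f \<in> borel_measurable borel" by (rule borel_measurable_conv) measurable
  have B: "(cmod (k t))\<^sup>2 \<le> B\<^sup>2" for t
    unfolding B_def by (intro power_mono norm_kernel_le) simp
  \<comment> \<open>Fubini would give this only for almost every \<open>t\<close>; boundedness of
    the kernel gives it for all \<open>t\<close>, so the pointwise estimate below has no exceptional
    set.\<close>
  have i1: "integrable lborel (\<lambda>s. cmod (f s) * (cmod (k (t - s)))\<^sup>2)" for t
  proof (rule Bochner_Integration.integrable_bound)
    show "integrable lborel (\<lambda>s. B\<^sup>2 * cmod (f s))" using f by simp
    show "AE s in lborel. norm (cmod (f s) * (cmod (k (t - s)))\<^sup>2) \<le> norm (B\<^sup>2 * cmod (f s))"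
      using B by (auto intro!: AE_I2 mult_left_mono simp: mult.commute[of "B\<^sup>2"])
  qed measurable
  have i2: "integrable (lborel \<Otimes>\<^sub>M lborel) (\<lambda>(s, t). cmod (f s) * (cmod (k (t - s)))\<^sup>2)"
  proof (rule lborel_pair.Fubini_integrable)
    have sq: "integrable lborel (\<lambda>t. (cmod (k (t - s)))\<^sup>2)" for s
      using sq_int_shift_minus[OF sq_int_kernel, of s] by (simp add: sq_int_def)
    have "(LINT t|lborel. (cmod (k (t - s)))\<^sup>2) = (l2norm k)\<^sup>2" for s
      using l2norm_shift[of k "-s"] by (simp add: l2norm_power2[symmetric])
    then show "integrable lborel
        (\<lambda>s. LINT t|lborel. norm (case (s, t) of (s, t) \<Rightarrow> cmod (f s) * (cmod (k (t - s)))\<^sup>2))"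
      using f by simp
    show "AE s in lborel. integrable lborel
        (\<lambda>t. case (s, t) of (s, t) \<Rightarrow> cmod (f s) * (cmod (k (t - s)))\<^sup>2)"
      using sq by simp
  qed measurable
  show "integrable lborel (\<lambda>t. (LINT s|lborel. cmod (f s)) * G t)"
    unfolding G_def using lborel_pair.integrable_snd[OF i2] by simp
  show "(cmod (conv k f t))\<^sup>2 \<le> (LINT s|lborel. cmod (f s)) * G t" for t
  proof -
    \<comment> \<open>Splitting \<open>|f| * |k|\<close> as \<open>sqrt |f|\<close> times
      \<open>sqrt |f| * |k|\<close> lets Cauchy-Schwarz separate the mass of \<open>f\<close> from
      \<open>|f| * |k|^2\<close>.\<close>
    define a b :: "real \<Rightarrow> complex"
      where "a s = sqrt (cmod (f s))" and "b s = sqrt (cmod (f s)) * cmod (k (t - s))" for s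
    have [measurable]: "a \<in> borel_measurable borel" "b \<in> borel_measurable borel"
      unfolding a_def[abs_def] b_def[abs_def] by measurable
    have ab: "(cmod (a s))\<^sup>2 = cmod (f s)" "(cmod (b s))\<^sup>2 = cmod (f s) * (cmod (k (t - s)))\<^sup>2" for s
      by (auto simp: a_def b_def norm_mult power_mult_distrib)
    have sq: "sq_int a" "sq_int b"
      unfolding sq_int_def ab using f i1[of t] by auto
    have "cmod (conv k f t) \<le> (LINT s|lborel. cmod (k (t - s) * f s))"
      unfolding conv_commute by (rule integral_norm_bound)
    also have "\<dots> = (LINT s|lborel. cmod (a s) * cmod (b s))"
      by (intro Bochner_Integration.integral_cong refl)
         (simp add: a_def b_def norm_mult flip: mult.assoc)
    also have "\<dots> \<le> l2norm a * l2norm b" by (rule l2_Cauchy_Schwarz_norm[OF sq])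
    finally have "(cmod (conv k f t))\<^sup>2 \<le> (l2norm a * l2norm b)\<^sup>2" by (intro power_mono) auto
    then show ?thesis by (simp add: power_mult_distrib l2norm_power2 ab G_def)
  qed
qed

text \<open>Fubini together with \<open>cnj_kernel\<close>. Cauchy-Schwarz bounds the integral over
  \<open>t\<close> by \<open>l2norm k * l2norm g\<close> uniformly in \<open>s\<close>, and
  integrability of \<open>f\<close> then takes care of the integral over \<open>s\<close>.\<close>

lemma conv_kernel_adjoint_L1:
  assumes f: "integrable lborel f" and g: "sq_int g"
  shows "l2inner (conv k f) g = l2inner f (conv k g)"
proof -
  have [measurable]: "f \<in> borel_measurable borel" "g \<in> borel_measurable borel"
    using f g borel_measurable_sq_int by auto
  have i: "integrable (lborel \<Otimes>\<^sub>M lborel) (\<lambda>(s, t). f s * (k (t - s) * cnj (g t)))"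
  proof (rule lborel_pair.Fubini_integrable)
    have i: "integrable lborel (\<lambda>t. k (t - s) * cnj (g t))" for s
      by (intro sq_int_integrable_mult sq_int_shift_minus sq_int_kernel sq_int_cnj g)
    then show "AE s in lborel. integrable lborel (\<lambda>t. case (s, t) of (s, t) \<Rightarrow> f s * (k (t - s) * cnj (g t)))"
      by simp
    have le: "(LINT t|lborel. cmod (k (t - s)) * cmod (g t)) \<le> l2norm k * l2norm g" for s
      using l2_Cauchy_Schwarz_norm[OF sq_int_shift_minus[OF sq_int_kernel] g, of s] l2norm_shift[of k "-s"]
      by simp
    show "integrable lborel (\<lambda>s. LINT t|lborel. norm (case (s, t) of (s, t) \<Rightarrow> f s * (k (t - s) * cnj (g t))))"
    proof (rule Bochner_Integration.integrable_bound)
      show "integrable lborel (\<lambda>s. f s * (l2norm k * l2norm g))" using f by simp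
      show "AE s in lborel. norm (LINT t|lborel. norm (case (s, t) of (s, t) \<Rightarrow> f s * (k (t - s) * cnj (g t))))
          \<le> norm (f s * (l2norm k * l2norm g))"
        using le by (auto simp: norm_mult abs_mult intro!: AE_I2 mult_left_mono)
    qed measurable
  qed measurable
  have "l2inner (conv k f) g = (LINT t|lborel. LINT s|lborel. f s * (k (t - s) * cnj (g t)))"
    unfolding l2inner_def conv_commute
    by (intro Bochner_Integration.integral_cong refl, subst integral_mult_left_zero[symmetric])
       (simp add: mult_ac)
  also have "\<dots> = (LINT s|lborel. LINT t|lborel. f s * (k (t - s) * cnj (g t)))"
    by (rule lborel_pair.Fubini_integral[OF i])
  also have "\<dots> = l2inner f (conv k g)"
    unfolding l2inner_def conv_commute
    by (intro Bochner_Integration.integral_cong refl, subst Bochner_Integration.integral_cnj[symmetric])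
       (simp add: cnj_kernel)
  finally show ?thesis .
qed

text \<open>The value of a convolution at \<open>t\<close> is an inner product with the shifted
  kernel. Moving the inner convolution across that inner product makes it act on the kernel, which
  it fixes.\<close>

lemma conv_kernel_idem_L1:
  assumes f: "integrable lborel f"
  shows "conv k (conv k f) t = conv k f t"
proof -
  have k: "conv k (\<lambda>s. k (s - t)) = (\<lambda>s. k (s - t))"
    using conv_shift[of k k "-t"] by (simp add: kernel_idem fun_eq_iff)
  have eq: "conv k g t = l2inner g (\<lambda>s. k (s - t))" for g
    by (simp add: conv_commute l2inner_def cnj_kernel mult.commute)
  show ?thesis
    unfolding eq
    by (subst conv_kernel_adjoint_L1[OF f sq_int_shift_minus[OF sq_int_kernel]]) (simp add: k)
qed

lemma l2norm_conv_kernel_L1_inner: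
  assumes f: "integrable lborel f"
  shows "(l2norm (conv k f))\<^sup>2 = l2inner f (conv k f)"
proof -
  have "conv k (conv k f) = conv k f" using conv_kernel_idem_L1[OF f] by (simp add: fun_eq_iff)
  then show ?thesis
    using conv_kernel_adjoint_L1[OF f conv_kernel_sq_int_L1[OF f]] l2inner_self[OF conv_kernel_sq_int_L1[OF f]]
    by simp
qed

lemma l2norm_conv_kernel_le_L1:
  assumes f: "integrable lborel f" "sq_int f"
  shows "l2norm (conv k f) \<le> l2norm f"
proof -
  have "(l2norm (conv k f))\<^sup>2 = cmod (l2inner f (conv k f))"
    unfolding l2norm_conv_kernel_L1_inner[OF f(1), symmetric] norm_of_real norm_power by simp
  also have "\<dots> \<le> l2norm f * l2norm (conv k f)"
    by (rule norm_l2inner_le[OF f(2) conv_kernel_sq_int_L1[OF f(1)]])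
  finally show ?thesis
    unfolding power2_eq_square
    by (metis l2norm_nonneg mult_le_cancel_right order_antisym_conv not_less nle_le)
qed

lemma integrable_band_ft:
  assumes f: "integrable lborel f"
  shows "integrable lborel (\<lambda>w. indicator A w * ft f w)"
proof (rule Bochner_Integration.integrable_bound)
  have [measurable]: "f \<in> borel_measurable borel" "A \<in> sets borel" "ft f \<in> borel_measurable borel"
    using f band_measurable borel_measurable_ft by auto
  show "integrable lborel (\<lambda>w. (LINT t|lborel. cmod (f t)) * (indicator A w :: complex))"
    using integrable_band by simp
  show "(\<lambda>w. indicator A w * ft f w) \<in> borel_measurable lborel" by measurable
  show "AE w in lborel. norm (indicator A w * ft f w) \<le> norm ((LINT t|lborel. cmod (f t)) * (indicator A w :: complex))"
    using norm_ft_le[of f] by (auto split: split_indicator intro: order_trans)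
qed

text \<open>Fourier inversion restricted to the band; the finite measure of the band makes the
  double integral absolutely convergent.\<close>

lemma conv_kernel_ft:
  assumes f: "integrable lborel f"
  shows "conv k f t = 1 / (2 * pi) * (LINT w|lborel. indicator A w * ft f w * cis (w * t))"
proof -
  have i: "integrable (lborel \<Otimes>\<^sub>M lborel) (\<lambda>(s, w). f s * indicator A w * cis (w * (t - s)))"
    by (rule integrable_pair_mult_bounded[OF f integrable_band]) simp_all
  have "conv k f t = (LINT s|lborel. 1 / (2 * pi) * (LINT w|lborel. f s * indicator A w * cis (w * (t - s))))"
    unfolding conv_commute kernel_eq
    by (simp add: mult_ac flip: integral_mult_left_zero)
  also have "\<dots> = 1 / (2 * pi) * (LINT s|lborel. LINT w|lborel. f s * indicator A w * cis (w * (t - s)))"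
    by simp
  also have "(LINT s|lborel. LINT w|lborel. f s * indicator A w * cis (w * (t - s)))
      = (LINT w|lborel. LINT s|lborel. f s * indicator A w * cis (w * (t - s)))"
    by (rule lborel_pair.Fubini_integral[OF i, symmetric])
  also have "\<dots> = (LINT w|lborel. indicator A w * ft f w * cis (w * t))"
  proof (intro Bochner_Integration.integral_cong refl)
    fix w :: real
    have "f s * indicator A w * cis (w * (t - s)) = (indicator A w * cis (w * t)) * (f s * cis (- (w * s)))" for s
      using cis_mult[of "w * t" "- (w * s)"] by (simp add: algebra_simps)
    then have "(LINT s|lborel. f s * indicator A w * cis (w * (t - s)))
        = (indicator A w * cis (w * t)) * ft f w"
      unfolding ft_def by (simp only: integral_mult_right_zero)
    then show "(LINT s|lborel. f s * indicator A w * cis (w * (t - s))) = indicator A w * ft f w * cis (w * t)"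
      by (simp add: mult_ac)
  qed
  finally show ?thesis .
qed

lemma l2norm_conv_kernel_L1:
  assumes f: "integrable lborel f"
  shows "(l2norm (conv k f))\<^sup>2 = 1 / (2 * pi) * (LINT w|lborel. indicator A w * (cmod (ft f w))\<^sup>2)"
proof -
  let ?G = "\<lambda>w. indicator A w * ft f w"
  have fc: "integrable lborel (\<lambda>t. cnj (f t))" using f by simp
  have i: "integrable (lborel \<Otimes>\<^sub>M lborel) (\<lambda>(t, w). cnj (f t) * ?G w * cis (w * t))"
    by (rule integrable_pair_mult_bounded[OF fc integrable_band_ft[OF f]]) simp_all
  have "l2inner (conv k f) f = (LINT t|lborel. 1 / (2 * pi) * (LINT w|lborel. cnj (f t) * ?G w * cis (w * t)))"
    unfolding l2inner_def conv_kernel_ft[OF f]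
    by (simp add: mult_ac flip: integral_mult_left_zero)
  also have "\<dots> = 1 / (2 * pi) * (LINT t|lborel. LINT w|lborel. cnj (f t) * ?G w * cis (w * t))"
    by simp
  also have "(LINT t|lborel. LINT w|lborel. cnj (f t) * ?G w * cis (w * t))
      = (LINT w|lborel. LINT t|lborel. cnj (f t) * ?G w * cis (w * t))"
    by (rule lborel_pair.Fubini_integral[OF i, symmetric])
  also have "\<dots> = (LINT w|lborel. complex_of_real (indicator A w * (cmod (ft f w))\<^sup>2))"
  proof (intro Bochner_Integration.integral_cong refl)
    fix w :: real
    have "(LINT t|lborel. cnj (f t) * ?G w * cis (w * t)) = ?G w * (LINT t|lborel. cnj (f t * cis (- (w * t))))"
      by (subst integral_mult_right_zero[symmetric]) (simp add: mult_ac cis_cnj)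
    also have "\<dots> = ?G w * cnj (ft f w)"
      unfolding ft_def by (subst Bochner_Integration.integral_cnj) simp
    finally show "(LINT t|lborel. cnj (f t) * ?G w * cis (w * t)) = complex_of_real (indicator A w * (cmod (ft f w))\<^sup>2)"
      by (simp add: complex_norm_square[unfolded of_real_power] split: split_indicator)
  qed
  also have "\<dots> = complex_of_real (LINT w|lborel. indicator A w * (cmod (ft f w))\<^sup>2)"
    by (rule integral_complex_of_real)
  finally have "l2inner (conv k f) f
      = complex_of_real (1 / (2 * pi) * (LINT w|lborel. indicator A w * (cmod (ft f w))\<^sup>2))"
    by simp
  \<comment> \<open>The energy was expressed with \<open>f\<close> in the first slot, the
    computation has it in the second. The computed value is real, so the conjugation is
    harmless.\<close>
  moreover have "l2inner (conv k f) f = cnj (l2inner f (conv k f))"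
    unfolding l2inner_def by (subst Bochner_Integration.integral_cnj[symmetric]) (simp add: mult.commute)
  ultimately show ?thesis
    unfolding l2norm_conv_kernel_L1_inner[OF f, symmetric] complex_cnj_complex_of_real of_real_eq_iff
    by (metis complex_cnj_complex_of_real of_real_eq_iff)
qed

end

lemma tendsto_l2inner_left:
  assumes lim: "((\<lambda>x. l2norm (\<lambda>t. F x t - f t)) \<longlongrightarrow> 0) A"
    and sq: "eventually (\<lambda>x. sq_int (F x)) A" "sq_int f" "sq_int g"
  shows "((\<lambda>x. l2inner (F x) g) \<longlongrightarrow> l2inner f g) A"
proof (rule LIM_zero_cancel, rule Lim_null_comparison)
  show "((\<lambda>x. l2norm (\<lambda>t. F x t - f t) * l2norm g) \<longlongrightarrow> 0) A"
    using lim by (rule tendsto_mult_left_zero)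
  show "eventually (\<lambda>x. norm (l2inner (F x) g - l2inner f g) \<le> l2norm (\<lambda>t. F x t - f t) * l2norm g) A"
    using sq(1)
  proof eventually_elim
    case (elim x)
    then show ?case
      using norm_l2inner_le[OF sq_int_diff[OF elim sq(2)] sq(3)] by (simp add: l2inner_diff_left sq)
  qed
qed

section \<open>Difference quotients in time and their spectra\<close>

definition diff_quot :: "real \<Rightarrow> (real \<Rightarrow> complex) \<Rightarrow> real \<Rightarrow> complex" where
  "diff_quot \<delta> f t = (f (t + \<delta>) - f t) / \<delta>"

lemma diff_quot_eq: "diff_quot \<delta> f = (\<lambda>t. (1 / \<delta>) * (f (t + \<delta>) - f t))"
  by (simp add: diff_quot_def fun_eq_iff)

lemma sq_int_diff_quot: "sq_int f \<Longrightarrow> sq_int (diff_quot \<delta> f)"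
  unfolding diff_quot_eq by (intro sq_int_cmult sq_int_diff sq_int_shift)

lemma integrable_diff_quot:
  assumes "integrable lborel f" shows "integrable lborel (diff_quot \<delta> f)"
  using lborel_integrable_real_affine[OF assms, of 1 \<delta>] assms
  unfolding diff_quot_eq by (simp add: add.commute)

lemma l2norm_diff_quot_le:
  assumes "sq_int f"
  shows "l2norm (diff_quot \<delta> f) \<le> 2 / \<bar>\<delta>\<bar> * l2norm f"
proof -
  have "l2norm (\<lambda>t. f (t + \<delta>) + (-1) * f t) \<le> l2norm (\<lambda>t. f (t + \<delta>)) + l2norm (\<lambda>t. (-1) * f t)"
    by (intro l2norm_triangle sq_int_shift sq_int_cmult assms)
  then have "l2norm (\<lambda>t. f (t + \<delta>) - f t) \<le> 2 * l2norm f"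
    unfolding l2norm_shift l2norm_cmult by simp
  then show ?thesis
    unfolding diff_quot_eq l2norm_cmult by (simp add: norm_divide divide_right_mono)
qed

lemma conv_diff_quot:
  assumes "sq_int k" "sq_int f"
  shows "conv k (diff_quot \<delta> f) = diff_quot \<delta> (conv k f)"
  unfolding diff_quot_eq
  by (rule ext) (simp add: conv_cmult conv_diff[OF assms(1) sq_int_shift[OF assms(2)] assms(2)] conv_shift
      del: times_divide_eq_left)

lemma ft_diff_quot:
  assumes f: "integrable lborel f"
  shows "ft (diff_quot \<delta> f) w = (cis (w * \<delta>) - 1) / \<delta> * ft f w"
proof -
  have i: "integrable lborel (\<lambda>t. f (t + \<delta>))"
    using lborel_integrable_real_affine[OF f, of 1 \<delta>] by (simp add: add.commute)
  have "ft (\<lambda>t. f (t + \<delta>)) w = (LINT t|lborel. f (t + \<delta>) * cis (- (w * t)))"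
    by (simp add: ft_def)
  also have "\<dots> = (LINT t|lborel. cis (w * \<delta>) * (f t * cis (- (w * t))))"
  proof -
    have "cis (w * \<delta>) * (f (t + \<delta>) * cis (- (w * (t + \<delta>)))) = f (t + \<delta>) * cis (- (w * t))" for t
      by (subst mult.left_commute, subst cis_mult) (simp add: distrib_left)
    note eq = this
    show ?thesis
      by (subst lborel_integral_real_affine[of 1 "\<lambda>t. cis (w * \<delta>) * (f t * cis (- (w * t)))" \<delta>])
         (simp_all only: eq add.commute[of \<delta>] mult_1 abs_one scaleR_one one_neq_zero not_False_eq_True)
  qed
  finally have sh: "ft (\<lambda>t. f (t + \<delta>)) w = cis (w * \<delta>) * ft f w" by (simp add: ft_def)
  have "ft (diff_quot \<delta> f) w = (LINT t|lborel. (1 / \<delta>) * (f (t + \<delta>) * cis (- (w * t)) - f t * cis (- (w * t))))"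
    by (simp add: ft_def diff_quot_def diff_divide_distrib algebra_simps)
  also have "\<dots> = (1 / \<delta>) * (ft (\<lambda>t. f (t + \<delta>)) w - ft f w)"
    unfolding ft_def integral_mult_right_zero
    using integrable_mult_cis[OF f, of "-w"] integrable_mult_cis[OF i, of "-w"]
    by (subst Bochner_Integration.integral_diff[symmetric]) simp_all
  finally show ?thesis by (simp add: sh field_simps)
qed

lemma norm_cis_minus_one_le: "cmod (cis x - 1) \<le> \<bar>x\<bar>"
proof (rule power2_le_imp_le)
  have "(cmod (cis x - 1))\<^sup>2 = 2 - 2 * cos x"
    using sin_cos_squared_add[of x] unfolding cmod_power2 by (simp add: power2_eq_square algebra_simps)
  also have "\<dots> = (2 * \<bar>sin (x / 2)\<bar>)\<^sup>2"
    using cos_double_sin[of "x / 2"] by (simp add: power_mult_distrib)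
  also have "\<dots> \<le> (2 * \<bar>x / 2\<bar>)\<^sup>2"
    by (intro power_mono mult_left_mono abs_sin_x_le_abs_x) auto
  finally show "(cmod (cis x - 1))\<^sup>2 \<le> \<bar>x\<bar>\<^sup>2" by simp
qed simp

lemma diff_quot_LIMSEQ:
  assumes "(f has_vector_derivative D) (at t)"
  shows "(\<lambda>n. diff_quot (1 / real (Suc n)) f t) \<longlonglongrightarrow> D"
proof -
  have "((\<lambda>h. (f (t + h) - f t) /\<^sub>R h) \<longlongrightarrow> D) (at 0)"
  proof (rule LIM_zero_cancel, rule tendsto_norm_zero_cancel, rule Lim_transform_eventually)
    show "((\<lambda>h. norm (f (t + h) - f t - h *\<^sub>R D) / norm h) \<longlongrightarrow> 0) (at 0)"
      using assms by (simp add: has_vector_derivative_def has_derivative_at)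
    have "norm (f (t + h) - f t - h *\<^sub>R D) / norm h = norm ((f (t + h) - f t) /\<^sub>R h - D)" if "h \<noteq> 0" for h
    proof -
      have "(f (t + h) - f t) /\<^sub>R h - D = (f (t + h) - f t - h *\<^sub>R D) /\<^sub>R h"
        using that by (simp add: scaleR_diff_right)
      then show ?thesis by (simp only: norm_scaleR) (simp add: divide_inverse mult.commute)
    qed
    then show "\<forall>\<^sub>F h in at 0. norm (f (t + h) - f t - h *\<^sub>R D) / norm h = norm ((f (t + h) - f t) /\<^sub>R h - D)"
      by (auto simp: eventually_at_filter)
  qed
  moreover have "filterlim (\<lambda>n. 1 / real (Suc n)) (at 0) sequentially"
    unfolding filterlim_at using LIMSEQ_Suc[OF lim_1_over_n] by auto
  ultimately have "(\<lambda>n. (f (t + 1 / real (Suc n)) - f t) /\<^sub>R (1 / real (Suc n))) \<longlonglongrightarrow> D"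
    by (rule filterlim_compose)
  then show ?thesis
    by (simp add: diff_quot_def scaleR_conv_of_real mult.commute divide_inverse)
qed

section \<open>Extension to square-integrable signals and Bernstein's inequality\<close>

context band_kernel
begin

lemma conv_kernel_truncate_tendsto:
  assumes f: "sq_int f"
  shows "(\<lambda>n. conv k (truncate (real n) f) t) \<longlonglongrightarrow> conv k f t"
proof (rule LIM_zero_cancel, rule Lim_null_comparison)
  show "(\<lambda>n. l2norm k * l2norm (\<lambda>t. f t - truncate (real n) f t)) \<longlonglongrightarrow> 0"
    by (rule tendsto_mult_right_zero[OF l2norm_truncate_tendsto[OF f]])
  show "\<forall>\<^sub>F n in sequentially. norm (conv k (truncate (real n) f) t - conv k f t)
      \<le> l2norm k * l2norm (\<lambda>t. f t - truncate (real n) f t)"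
  proof (rule always_eventually, rule allI)
    fix n
    have "conv k f t - conv k (truncate (real n) f) t = conv k (\<lambda>t. f t - truncate (real n) f t) t"
      by (simp add: conv_diff sq_int_kernel f sq_int_truncate)
    then show "norm (conv k (truncate (real n) f) t - conv k f t)
        \<le> l2norm k * l2norm (\<lambda>t. f t - truncate (real n) f t)"
      using norm_conv_le[OF sq_int_kernel sq_int_diff[OF f sq_int_truncate[OF f]]]
      by (metis norm_minus_commute)
  qed
qed

text \<open>Truncations have filtered versions bounded by \<open>l2norm f\<close> and converging
  pointwise, so Fatou passes both claims to the limit.\<close>

lemma sq_int_conv_kernel: "sq_int f \<Longrightarrow> sq_int (conv k f)"
  and l2norm_conv_kernel_le: "sq_int f \<Longrightarrow> l2norm (conv k f) \<le> l2norm f"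
proof -
  assume f: "sq_int f"
  have "l2norm (conv k (truncate (real n) f)) \<le> l2norm f" for n
    using l2norm_conv_kernel_le_L1[OF integrable_truncate[OF f] sq_int_truncate[OF f]]
      l2norm_truncate_le[OF f] order_trans by blast
  note * = sq_int_LIMSEQ[OF _ conv_kernel_truncate_tendsto[OF f] this]
  show "sq_int (conv k f)" "l2norm (conv k f) \<le> l2norm f"
    by (rule *; rule conv_kernel_sq_int_L1[OF integrable_truncate[OF f]])+
qed

lemma l2norm_conv_kernel_diff_tendsto:
  assumes lim: "(\<lambda>n. l2norm (\<lambda>t. f t - F n t)) \<longlonglongrightarrow> 0" and sq: "sq_int f" "\<And>n. sq_int (F n)"
  shows "(\<lambda>n. l2norm (\<lambda>t. conv k f t - conv k (F n) t)) \<longlonglongrightarrow> 0"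
proof (rule Lim_null_comparison[OF _ lim], rule always_eventually, rule allI)
  fix n
  show "norm (l2norm (\<lambda>t. conv k f t - conv k (F n) t)) \<le> l2norm (\<lambda>t. f t - F n t)"
    using l2norm_conv_kernel_le[OF sq_int_diff[OF sq(1) sq(2)[of n]]]
    by (simp add: conv_diff[OF sq_int_kernel sq(1) sq(2)[of n], abs_def])
qed

lemma l2norm_conv_kernel_tendsto:
  assumes "(\<lambda>n. l2norm (\<lambda>t. f t - F n t)) \<longlonglongrightarrow> 0" and "sq_int f" "\<And>n. sq_int (F n)"
  shows "(\<lambda>n. l2norm (conv k (F n))) \<longlonglongrightarrow> l2norm (conv k f)"
  using l2norm_conv_kernel_diff_tendsto[OF assms]
  by (intro tendsto_l2norm) (auto simp: assms sq_int_conv_kernel l2norm_minus_commute[of "conv k f"])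

lemma conv_kernel_adjoint:
  assumes f: "sq_int f" and g: "sq_int g"
  shows "l2inner (conv k f) g = l2inner f (conv k g)"
proof (rule LIMSEQ_unique)
  note tr = l2norm_truncate_tendsto[OF f] sq_int_truncate[OF f]
  show "(\<lambda>n. l2inner (conv k (truncate (real n) f)) g) \<longlonglongrightarrow> l2inner (conv k f) g"
    using l2norm_conv_kernel_diff_tendsto[OF tr(1) f tr(2)]
    by (intro tendsto_l2inner_left)
       (simp_all add: sq_int_conv_kernel tr f g l2norm_minus_commute[of "conv k f"])
  have "(\<lambda>n. l2inner (truncate (real n) f) (conv k g)) \<longlonglongrightarrow> l2inner f (conv k g)"
    using tr(1)
    by (intro tendsto_l2inner_left) (simp_all add: sq_int_conv_kernel tr(2) f g l2norm_minus_commute[of f])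
  then show "(\<lambda>n. l2inner (conv k (truncate (real n) f)) g) \<longlonglongrightarrow> l2inner f (conv k g)"
    by (simp add: conv_kernel_adjoint_L1[OF integrable_truncate[OF f] g])
qed

text \<open>On the spectrum a difference quotient is multiplication by
  \<open>(cis (w * \<delta>) - 1) / \<delta>\<close>, whose modulus is at most \<open>|w|\<close>
  because a chord is no longer than its arc. On the band this is at most \<open>M\<close>, uniformly
  in \<open>\<delta>\<close>.\<close>

lemma l2norm_conv_diff_quot_le_L1:
  assumes f: "integrable lborel f" and \<delta>: "\<delta> \<noteq> 0"
  shows "l2norm (conv k (diff_quot \<delta> f)) \<le> M * l2norm (conv k f)"
proof (rule power2_le_imp_le)
  let ?B = "LINT t|lborel. cmod (f t)"
  have B: "0 \<le> ?B" by simp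
  have [measurable]: "f \<in> borel_measurable borel" "A \<in> sets borel" "ft f \<in> borel_measurable borel"
    using f band_measurable borel_measurable_ft by auto
  have i: "integrable lborel (\<lambda>w. indicator A w * (cmod (ft f w))\<^sup>2)"
  proof (rule Bochner_Integration.integrable_bound)
    show "integrable lborel (\<lambda>w. ?B * (indicator A w * ft f w))"
      using integrable_band_ft[OF f] by simp
    show "AE w in lborel. norm (indicator A w * (cmod (ft f w))\<^sup>2) \<le> norm (?B * (indicator A w * ft f w))"
      using norm_ft_le[of f] B
      by (auto split: split_indicator simp: norm_mult power2_eq_square intro!: mult_right_mono)
  qed measurable
  have le: "indicator A w * (cmod (ft (diff_quot \<delta> f) w))\<^sup>2 \<le> M\<^sup>2 * (indicator A w * (cmod (ft f w))\<^sup>2)" for w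
  proof (cases "w \<in> A")
    case True
    have "cmod (cis (w * \<delta>) - 1) / \<bar>\<delta>\<bar> \<le> \<bar>w\<bar>"
      using norm_cis_minus_one_le[of "w * \<delta>"] \<delta> by (simp add: divide_le_eq abs_mult)
    also have "\<dots> \<le> M" by (rule band_bounded[OF True])
    finally have "cmod ((cis (w * \<delta>) - 1) / \<delta>) \<le> M" by (simp add: norm_divide)
    then have "(cmod ((cis (w * \<delta>) - 1) / \<delta>))\<^sup>2 * (cmod (ft f w))\<^sup>2 \<le> M\<^sup>2 * (cmod (ft f w))\<^sup>2"
      by (intro mult_right_mono power_mono) auto
    then show ?thesis
      using True by (simp add: ft_diff_quot[OF f] norm_mult norm_divide power_mult_distrib power_divide)
  qed simp
  have "(LINT w|lborel. indicator A w * (cmod (ft (diff_quot \<delta> f) w))\<^sup>2)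
      \<le> (LINT w|lborel. M\<^sup>2 * (indicator A w * (cmod (ft f w))\<^sup>2))"
    by (rule integral_mono_AE') (use i le in auto)
  then show "(l2norm (conv k (diff_quot \<delta> f)))\<^sup>2 \<le> (M * l2norm (conv k f))\<^sup>2"
    unfolding power_mult_distrib l2norm_conv_kernel_L1[OF f] l2norm_conv_kernel_L1[OF integrable_diff_quot[OF f]]
    by (simp add: divide_right_mono)
qed (simp add: bound_nonneg)

text \<open>Truncation destroys band limitation, so the inequality is carried to the limit with the
  filter on both sides, and \<open>bl\<close> removes it only at the end. The factor
  \<open>2 / |\<delta>|\<close> in the approximation does no harm since \<open>\<delta>\<close>
  stays fixed.\<close>

lemma l2norm_diff_quot_band_limited_le:
  assumes f: "sq_int f" and bl: "conv k f = f" and \<delta>: "\<delta> \<noteq> 0"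
  shows "l2norm (diff_quot \<delta> f) \<le> M * l2norm f"
proof -
  note tr = l2norm_truncate_tendsto[OF f] sq_int_truncate[OF f]
  have "(\<lambda>n. l2norm (\<lambda>t. diff_quot \<delta> f t - diff_quot \<delta> (truncate (real n) f) t)) \<longlonglongrightarrow> 0"
  proof (rule Lim_null_comparison)
    show "(\<lambda>n. 2 / \<bar>\<delta>\<bar> * l2norm (\<lambda>t. f t - truncate (real n) f t)) \<longlonglongrightarrow> 0"
      by (rule tendsto_mult_right_zero[OF tr(1)])
    show "\<forall>\<^sub>F n in sequentially. norm (l2norm (\<lambda>t. diff_quot \<delta> f t - diff_quot \<delta> (truncate (real n) f) t))
        \<le> 2 / \<bar>\<delta>\<bar> * l2norm (\<lambda>t. f t - truncate (real n) f t)"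
    proof (rule always_eventually, rule allI)
      fix n
      have "(\<lambda>t. diff_quot \<delta> f t - diff_quot \<delta> (truncate (real n) f) t)
          = diff_quot \<delta> (\<lambda>t. f t - truncate (real n) f t)"
        by (simp add: diff_quot_def fun_eq_iff diff_divide_distrib)
      then show "norm (l2norm (\<lambda>t. diff_quot \<delta> f t - diff_quot \<delta> (truncate (real n) f) t))
          \<le> 2 / \<bar>\<delta>\<bar> * l2norm (\<lambda>t. f t - truncate (real n) f t)"
        using l2norm_diff_quot_le[OF sq_int_diff[OF f tr(2)]] by simp
    qed
  qed
  then have 1: "(\<lambda>n. l2norm (conv k (diff_quot \<delta> (truncate (real n) f)))) \<longlonglongrightarrow> l2norm (conv k (diff_quot \<delta> f))"
    by (intro l2norm_conv_kernel_tendsto sq_int_diff_quot f tr)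
  have 2: "(\<lambda>n. M * l2norm (conv k (truncate (real n) f))) \<longlonglongrightarrow> M * l2norm (conv k f)"
    by (intro tendsto_mult_left l2norm_conv_kernel_tendsto f tr)
  have "l2norm (conv k (diff_quot \<delta> f)) \<le> M * l2norm (conv k f)"
    by (rule LIMSEQ_le[OF 1 2]) (auto intro: l2norm_conv_diff_quot_le_L1[OF integrable_truncate[OF f] \<delta>])
  then show ?thesis by (simp add: conv_diff_quot[OF sq_int_kernel f] bl)
qed

text \<open>The uniform bound on difference quotients survives the passage to the derivative by
  Fatou; differentiation under the integral sign does not occur.\<close>

lemma sq_int_derivatives_band_limited:
  assumes f: "sq_int f" and bl: "conv k f = f"
    and f': "\<And>t. (f has_vector_derivative f' t) (at t)"
    and f'': "\<And>t. (f' has_vector_derivative f'' t) (at t)"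
  shows "sq_int f'" "sq_int f''"
proof -
  let ?d = "\<lambda>n. 1 / real (Suc n)"
  have b1: "l2norm (diff_quot (?d n) f) \<le> M * l2norm f" for n
    by (rule l2norm_diff_quot_band_limited_le[OF f bl]) simp
  show f'_sq: "sq_int f'"
    by (rule sq_int_LIMSEQ[OF sq_int_diff_quot[OF f] diff_quot_LIMSEQ[OF f'] b1])
  \<comment> \<open>Band limitation of \<open>f'\<close> is not at hand. The quotients of
    \<open>f'\<close> are limits of iterated quotients of \<open>f\<close>, which the filter does
    fix, as convolution commutes with translations; each quotient contributes one factor
    \<open>M\<close>.\<close>
  have b2: "l2norm (diff_quot \<delta> f') \<le> M * (M * l2norm f)" if \<delta>: "\<delta> \<noteq> 0" for \<delta>
  proof (rule sq_int_LIMSEQ)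
    show "sq_int (diff_quot \<delta> (diff_quot (?d n) f))" for n
      by (intro sq_int_diff_quot f)
    show "(\<lambda>n. diff_quot \<delta> (diff_quot (?d n) f) t) \<longlonglongrightarrow> diff_quot \<delta> f' t" for t
      unfolding diff_quot_def[of \<delta>] using \<delta> by (intro tendsto_intros diff_quot_LIMSEQ f') simp
    show "l2norm (diff_quot \<delta> (diff_quot (?d n) f)) \<le> M * (M * l2norm f)" for n
    proof (rule order_trans)
      show "l2norm (diff_quot \<delta> (diff_quot (?d n) f)) \<le> M * l2norm (diff_quot (?d n) f)"
        by (rule l2norm_diff_quot_band_limited_le[OF sq_int_diff_quot[OF f] _ \<delta>])
           (simp add: conv_diff_quot[OF sq_int_kernel f] bl)
      show "M * l2norm (diff_quot (?d n) f) \<le> M * (M * l2norm f)"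
        by (intro mult_left_mono b1 bound_nonneg)
    qed
  qed
  show "sq_int f''"
    by (rule sq_int_LIMSEQ[OF sq_int_diff_quot[OF f'_sq] diff_quot_LIMSEQ[OF f''] b2]) simp
qed

end

subsection \<open>The ideal band-pass filter\<close>

definition band_pass :: "real set \<Rightarrow> real \<Rightarrow> complex" where
  "band_pass A t = 1 / (2 * pi) * (LINT w|lborel. indicator A w * cis (w * t))"

lemma band_pass_Icc:
  assumes "a \<le> b" "t \<noteq> 0"
  shows "band_pass {a..b} t = (cis (b * t) - cis (a * t)) / (2 * pi * \<i> * t)"
proof -
  have "(LINT w|lborel. indicator {a..b} w *\<^sub>R cis (w * t))
      = cis (b * t) / (\<i> * t) - cis (a * t) / (\<i> * t)"
  proof (rule integral_FTC_atLeastAtMost[OF assms(1)])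
    show "((\<lambda>w. cis (w * t) / (\<i> * t)) has_vector_derivative cis (w * t)) (at w within {a..b})" for w
      unfolding cis_conv_exp using assms(2)
      by (auto intro!: derivative_eq_intros has_vector_derivative_real_field simp: complex_eq_iff)
    show "continuous_on {a..b} (\<lambda>w. cis (w * t))" by (intro continuous_intros)
  qed
  then have "(LINT w|lborel. indicator {a..b} w * cis (w * t)) = (cis (b * t) - cis (a * t)) / (\<i> * t)"
    by (simp add: scaleR_conv_of_real of_real_indicator diff_divide_distrib)
  then show ?thesis
    unfolding band_pass_def by (simp add: mult_ac)
qed

lemma integrable_indicator_Icc: "integrable lborel (indicator {a..b::real} :: real \<Rightarrow> complex)"
  using integrable_indicator[of "{a..b}" lborel "1::complex"]
  by (simp add: scaleR_conv_of_real of_real_indicator emeasure_lborel_Icc_eq)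

lemma cmod_indicator: "cmod (indicator A x) = indicator A x"
  by (simp split: split_indicator)

lemma norm_band_pass_Icc_le: "a \<le> b \<Longrightarrow> cmod (band_pass {a..b} t) \<le> b - a"
proof -
  assume ab: "a \<le> b"
  have "cmod (LINT w|lborel. indicator {a..b} w * cis (w * t)) \<le> (LINT w|lborel. indicator {a..b} w)"
    using integral_norm_bound[of lborel "\<lambda>w. indicator {a..b} w * cis (w * t)"]
    by (simp add: norm_mult cmod_indicator)
  also have "\<dots> = b - a" using ab by simp
  finally have "cmod (band_pass {a..b} t) \<le> (b - a) / (2 * pi)"
    by (simp add: band_pass_def norm_mult norm_divide divide_right_mono)
  also have "\<dots> \<le> (b - a) / 1"
    using ab pi_gt3 by (intro divide_left_mono) auto
  finally show ?thesis by simp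
qed

lemma borel_measurable_band_pass:
  assumes [measurable]: "A \<in> sets borel"
  shows "band_pass A \<in> borel_measurable borel"
  unfolding band_pass_def[abs_def] by measurable

lemma integrable_inverse_1_plus_square_UNIV: "integrable lborel (\<lambda>x::real. inverse (1 + x\<^sup>2))"
  using integrable_inverse_1_plus_square by (simp add: set_integrable_def)

lemma sq_int_band_pass_Icc:
  assumes ab: "a \<le> b"
  shows "sq_int (band_pass {a..b})"
proof (rule sq_int_boundI)
  \<comment> \<open>Sum of the squares of two bounds on the kernel: \<open>b - a\<close> everywhere,
    and \<open>1 / |t|\<close> away from 0.\<close>
  let ?C = "(b - a)\<^sup>2 + 1"
  show "band_pass {a..b} \<in> borel_measurable borel" by (rule borel_measurable_band_pass) simp
  show "integrable lborel (\<lambda>t. ?C * inverse (1 + t\<^sup>2))"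
    using integrable_inverse_1_plus_square_UNIV by simp
  show "(cmod (band_pass {a..b} t))\<^sup>2 \<le> ?C * inverse (1 + t\<^sup>2)" for t
  proof -
    let ?x = "cmod (band_pass {a..b} t)"
    have 1: "?x\<^sup>2 \<le> (b - a)\<^sup>2" by (intro power_mono norm_band_pass_Icc_le ab) simp
    have "?x * \<bar>t\<bar> \<le> 1"
    proof (cases "t = 0")
      case False
      have "cmod (cis (b * t) - cis (a * t)) \<le> 2"
        using norm_triangle_ineq4[of "cis (b * t)" "cis (a * t)"] by simp
      moreover have "2 \<le> 2 * pi" using pi_gt3 by simp
      ultimately have "cmod (cis (b * t) - cis (a * t)) \<le> 2 * pi" by linarith
      then show ?thesis
        using False by (simp add: band_pass_Icc[OF ab] norm_divide norm_mult)
    qed simp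
    then have "(?x * \<bar>t\<bar>)\<^sup>2 \<le> 1\<^sup>2" by (intro power_mono) auto
    then have "?x\<^sup>2 * (1 + t\<^sup>2) \<le> ?C"
      using 1 by (simp add: power_mult_distrib algebra_simps)
    moreover have "0 < 1 + t\<^sup>2" by (simp add: add_pos_nonneg)
    ultimately show ?thesis by (simp add: field_simps)
  qed
qed

section \<open>Sine integrals and idempotence of the interval filters\<close>

lemma Si_uminus: "Si (- x) = - Si x"
  using Si_neg[of x] Si_neg[of "- x"] by (cases "0 \<le> x") auto

lemma Si_scaled_tendsto:
  assumes "x \<noteq> 0"
  shows "(\<lambda>n. Si (real n * x)) \<longlonglongrightarrow> sgn x * (pi / 2)"
proof -
  have pos: "(\<lambda>n. Si (real n * y)) \<longlonglongrightarrow> pi / 2" if "y > 0" for y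
    by (rule filterlim_compose[OF Si_at_top])
       (rule filterlim_at_top_mult_tendsto_pos[OF tendsto_const that filterlim_real_sequentially])
  show ?thesis
  proof (cases "x > 0")
    case False
    then have "(\<lambda>n. - Si (real n * (- x))) \<longlonglongrightarrow> - (pi / 2)"
      using assms by (intro tendsto_minus pos) simp
    then show ?thesis using False assms by (simp add: Si_uminus)
  qed (simp add: pos)
qed

lemma band_pass_symmetric: "0 \<le> T \<Longrightarrow> band_pass {-T..T} x = T / pi * Sinc_Integral.sinc (T * x)"
proof (cases "x = 0")
  case False
  have "cis (T * x) - cis (- T * x) = 2 * \<i> * sin (T * x)" by (simp add: complex_eq_iff)
  moreover assume "0 \<le> T"
  ultimately show ?thesis
    using False by (simp add: band_pass_Icc field_simps)
next
  case True
  moreover assume T: "0 \<le> T"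
  have "(LINT w|lborel. indicator {-T..T} w :: complex) = 2 * T"
    using T integral_complex_of_real[of lborel "indicator {-T..T}"] by (simp add: of_real_indicator)
  ultimately show ?thesis by (simp add: band_pass_def)
qed

lemma ft_truncate_band_pass:
  assumes ab: "a \<le> b" and T: "0 \<le> T"
  shows "ft (truncate T (band_pass {a..b})) w = (Si (T * (b - w)) - Si (T * (a - w))) / pi"
proof -
  have i: "integrable (lborel \<Otimes>\<^sub>M lborel)
      (\<lambda>(t, v). indicator {-T..T} t * indicator {a..b} v * cis (t * (v - w)))"
    by (rule integrable_pair_mult_bounded) (simp_all add: integrable_indicator_Icc)
  have "ft (truncate T (band_pass {a..b})) w = (LINT t|lborel. 1 / (2 * pi) *
      (LINT v|lborel. indicator {-T..T} t * indicator {a..b} v * cis (t * (v - w))))"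
    unfolding ft_def
  proof (intro Bochner_Integration.integral_cong refl)
    fix t :: real
    have "indicator {-T..T} t * indicator {a..b} v * cis (t * (v - w))
        = (indicator {-T..T} t * cis (- (w * t))) * (indicator {a..b} v * cis (v * t))" for v
      using cis_mult[of "- (w * t)" "v * t"] by (simp add: algebra_simps)
    then have "(LINT v|lborel. indicator {-T..T} t * indicator {a..b} v * cis (t * (v - w)))
        = (indicator {-T..T} t * cis (- (w * t))) * (LINT v|lborel. indicator {a..b} v * cis (v * t))"
      by (simp only: integral_mult_right_zero)
    then show "truncate T (band_pass {a..b}) t * cis (- (w * t)) = 1 / (2 * pi) *
        (LINT v|lborel. indicator {-T..T} t * indicator {a..b} v * cis (t * (v - w)))"
      by (simp add: truncate_def band_pass_def mult_ac)
  qed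
  also have "\<dots> = 1 / (2 * pi) * (LINT t|lborel. LINT v|lborel.
      indicator {-T..T} t * indicator {a..b} v * cis (t * (v - w)))"
    by simp
  also have "(LINT t|lborel. LINT v|lborel. indicator {-T..T} t * indicator {a..b} v * cis (t * (v - w)))
      = (LINT v|lborel. LINT t|lborel. indicator {-T..T} t * indicator {a..b} v * cis (t * (v - w)))"
    by (rule lborel_pair.Fubini_integral[OF i, symmetric])
  also have "\<dots> = (LINT v|lborel. complex_of_real (indicator {a..b} v *\<^sub>R (2 * (T * Sinc_Integral.sinc (T * (v - w))))))"
  proof (intro Bochner_Integration.integral_cong refl)
    fix v :: real
    have "(LINT t|lborel. indicator {-T..T} t * indicator {a..b} v * cis (t * (v - w)))
        = indicator {a..b} v * (LINT t|lborel. indicator {-T..T} t * cis (t * (v - w)))"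
      by (simp add: mult_ac flip: integral_mult_right_zero)
    \<comment> \<open>Time and frequency exchange roles: the window \<open>[-T, T]\<close> acts as a
      band, and its kernel is evaluated at the frequency difference \<open>v - w\<close>.
      Integrating it over \<open>v\<close> produces \<open>Si\<close>.\<close>
    also have "(LINT t|lborel. indicator {-T..T} t * cis (t * (v - w))) = 2 * pi * band_pass {-T..T} (v - w)"
      by (simp add: band_pass_def)
    finally show "(LINT t|lborel. indicator {-T..T} t * indicator {a..b} v * cis (t * (v - w)))
        = complex_of_real (indicator {a..b} v *\<^sub>R (2 * (T * Sinc_Integral.sinc (T * (v - w)))))"
      unfolding band_pass_symmetric[OF T] by (simp add: of_real_indicator)
  qed
  also have "\<dots> = complex_of_real (LINT v|lborel. indicator {a..b} v *\<^sub>R (2 * (T * Sinc_Integral.sinc (T * (v - w)))))"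
    by (rule integral_complex_of_real)
  also have "(LINT v|lborel. indicator {a..b} v *\<^sub>R (2 * (T * Sinc_Integral.sinc (T * (v - w)))))
      = 2 * Si (T * (b - w)) - 2 * Si (T * (a - w))"
  proof (rule integral_FTC_atLeastAtMost[OF ab])
    show "((\<lambda>v. 2 * Si (T * (v - w))) has_vector_derivative 2 * (T * Sinc_Integral.sinc (T * (v - w)))) (at v within {a..b})" for v
      unfolding has_real_derivative_iff_has_vector_derivative[symmetric]
      by (rule DERIV_subset[of _ _ _ UNIV])
         (auto intro!: derivative_eq_intros DERIV_chain2[OF DERIV_Si] simp del: mult_eq_0_iff)
    show "continuous_on {a..b} (\<lambda>v. 2 * (T * Sinc_Integral.sinc (T * (v - w))))"
      by (intro continuous_intros)
  qed
  also have "1 / (2 * pi) * complex_of_real (2 * Si (T * (b - w)) - 2 * Si (T * (a - w)))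
      = (Si (T * (b - w)) - Si (T * (a - w))) / pi"
    by (simp add: field_simps)
  finally show ?thesis .
qed

text \<open>Truncating the first factor to \<open>[-n, n]\<close> and integrating over the frequencies of the
  second, the spectrum of the truncated factor is a difference of sine integrals, which
  converges boundedly to the indicator of \<open>[a, b]\<close>.\<close>
lemma conv_band_pass_Icc:
  assumes ab: "a \<le> b" and cd: "c \<le> d"
  shows "conv (band_pass {a..b}) (band_pass {c..d}) u = band_pass ({a..b} \<inter> {c..d}) u"
proof (rule LIMSEQ_unique)
  let ?K = "band_pass {a..b}" and ?L = "band_pass {c..d}"
  have [measurable]: "?K \<in> borel_measurable borel" "?L \<in> borel_measurable borel"
    by (simp_all add: borel_measurable_band_pass)
  note sq = sq_int_band_pass_Icc[OF ab] sq_int_band_pass_Icc[OF cd]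
  show "(\<lambda>n. conv (truncate (real n) ?K) ?L u) \<longlonglongrightarrow> conv ?K ?L u"
    unfolding conv_def
  proof (rule integral_dominated_convergence)
    show "integrable lborel (\<lambda>s. cmod (?K s) * cmod (?L (u - s)))"
      by (intro sq_int_integrable_norm_mult sq_int_reflect sq)
    show "AE s in lborel. (\<lambda>n. truncate (real n) ?K s * ?L (u - s)) \<longlonglongrightarrow> ?K s * ?L (u - s)"
    proof (rule AE_I2)
      fix s :: real
      obtain m where "\<bar>s\<bar> \<le> real m" using real_arch_simple by blast
      then have "eventually (\<lambda>n. truncate (real n) ?K s * ?L (u - s) = ?K s * ?L (u - s)) sequentially"
        unfolding eventually_sequentially
        by (intro exI[of _ m]) (auto simp: truncate_def abs_le_iff)
      then show "(\<lambda>n. truncate (real n) ?K s * ?L (u - s)) \<longlonglongrightarrow> ?K s * ?L (u - s)"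
        by (rule tendsto_eventually)
    qed
  qed (auto simp: truncate_def norm_mult split: split_indicator)
  define J where "J n w = (Si (real n * (b - w)) - Si (real n * (a - w))) / pi" for n w
  have [measurable]: "J n \<in> borel_measurable borel" for n
    unfolding J_def[abs_def] by measurable
  have eq: "conv (truncate (real n) ?K) ?L u
      = 1 / (2 * pi) * (LINT w|lborel. indicator {c..d} w * cis (w * u) * J n w)" for n
  proof -
    have i: "integrable (lborel \<Otimes>\<^sub>M lborel)
        (\<lambda>(s, w). truncate (real n) ?K s * indicator {c..d} w * cis (w * (u - s)))"
      by (rule integrable_pair_mult_bounded)
         (simp_all add: integrable_indicator_Icc integrable_truncate[OF sq(1)])
    have "conv (truncate (real n) ?K) ?L u = (LINT s|lborel. 1 / (2 * pi) *
        (LINT w|lborel. truncate (real n) ?K s * indicator {c..d} w * cis (w * (u - s))))"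
      unfolding conv_def band_pass_def[of "{c..d}"]
      by (simp add: mult.assoc)
    also have "\<dots> = 1 / (2 * pi) * (LINT s|lborel. LINT w|lborel.
        truncate (real n) ?K s * indicator {c..d} w * cis (w * (u - s)))"
      by simp
    also have "(LINT s|lborel. LINT w|lborel. truncate (real n) ?K s * indicator {c..d} w * cis (w * (u - s)))
        = (LINT w|lborel. LINT s|lborel. truncate (real n) ?K s * indicator {c..d} w * cis (w * (u - s)))"
      by (rule lborel_pair.Fubini_integral[OF i, symmetric])
    also have "\<dots> = (LINT w|lborel. indicator {c..d} w * cis (w * u) * ft (truncate (real n) ?K) w)"
    proof (intro Bochner_Integration.integral_cong refl)
      fix w :: real
      have "truncate (real n) ?K s * indicator {c..d} w * cis (w * (u - s))
          = (indicator {c..d} w * cis (w * u)) * (truncate (real n) ?K s * cis (- (w * s)))" for s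
        using cis_mult[of "w * u" "- (w * s)"] by (simp add: algebra_simps)
      then show "(LINT s|lborel. truncate (real n) ?K s * indicator {c..d} w * cis (w * (u - s)))
          = indicator {c..d} w * cis (w * u) * ft (truncate (real n) ?K) w"
        unfolding ft_def by (simp only: integral_mult_right_zero)
    qed
    finally show ?thesis by (simp add: ft_truncate_band_pass[OF ab] J_def)
  qed
  obtain B where B: "\<And>x. \<bar>Si x\<bar> \<le> B" using bounded_Si by auto
  have "(\<lambda>n. LINT w|lborel. indicator {c..d} w * cis (w * u) * J n w)
      \<longlonglongrightarrow> (LINT w|lborel. indicator ({a..b} \<inter> {c..d}) w * cis (w * u))"
  proof (rule integral_dominated_convergence)
    show "integrable lborel (\<lambda>w. 2 * B / pi * indicator {c..d} w :: real)"
      by (intro integrable_mult_right integrable_real_indicator) (simp_all add: emeasure_lborel_Icc_eq)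
    \<comment> \<open>At an endpoint one of the two sine integrals stays at \<open>Si 0 = 0\<close>,
      so the limit there differs from the indicator; two points form a null set.\<close>
    have "AE w in lborel. w \<noteq> a \<and> w \<noteq> b"
      using AE_lborel_singleton[of a] AE_lborel_singleton[of b] by eventually_elim simp
    then show "AE w in lborel. (\<lambda>n. indicator {c..d} w * cis (w * u) * J n w)
        \<longlonglongrightarrow> indicator ({a..b} \<inter> {c..d}) w * cis (w * u)"
    proof eventually_elim
      case (elim w)
      have "(\<lambda>n. J n w) \<longlonglongrightarrow> (sgn (b - w) * (pi / 2) - sgn (a - w) * (pi / 2)) / pi"
        unfolding J_def using elim by (intro tendsto_intros Si_scaled_tendsto) auto
      also have "(sgn (b - w) * (pi / 2) - sgn (a - w) * (pi / 2)) / pi = indicator {a..b} w"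
        using elim ab by (auto simp: indicator_def sgn_if)
      finally have "(\<lambda>n. indicator {c..d} w * cis (w * u) * complex_of_real (J n w))
          \<longlonglongrightarrow> indicator {c..d} w * cis (w * u) * complex_of_real (indicator {a..b} w)"
        by (intro tendsto_intros)
      then show ?case by (simp add: indicator_inter_arith of_real_indicator mult_ac del: Int_atLeastAtMost)
    qed
    have J: "\<bar>J n w\<bar> \<le> 2 * B / pi" for n w
      using B[of "real n * (b - w)"] B[of "real n * (a - w)"]
      by (auto simp: J_def abs_divide intro!: divide_right_mono)
    show "AE w in lborel. norm (indicator {c..d} w * cis (w * u) * J n w) \<le> 2 * B / pi * indicator {c..d} w" for n
      using J by (auto simp: norm_mult split: split_indicator)
  qed measurable
  then show "(\<lambda>n. conv (truncate (real n) ?K) ?L u) \<longlonglongrightarrow> band_pass ({a..b} \<inter> {c..d}) u"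
    unfolding eq band_pass_def by (intro tendsto_mult_left)
qed

section \<open>Square integrability of spectra and the energy inside the band\<close>

lemma band_kernel_Icc:
  assumes "0 \<le> M"
  shows "band_kernel {-M..M} M (band_pass {-M..M})"
proof unfold_locales
  show "band_pass {-M..M} t = 1 / (2 * pi) * (LINT w|lborel. indicator {-M..M} w * cis (w * t))" for t
    by (rule band_pass_def)
qed (use assms in \<open>auto simp: sq_int_band_pass_Icc conv_band_pass_Icc abs_le_iff\<close>)

text \<open>One half of Plancherel's theorem: on \<open>[-n, n]\<close> the energy of the spectrum
  is \<open>2 * pi\<close> times that of a filtered signal, and the filter is a contraction. Fatou
  lets \<open>n\<close> tend to infinity.\<close>

lemma sq_int_ft:
  assumes f: "integrable lborel f" "sq_int f"
  shows "sq_int (ft f)"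
proof (rule sq_int_LIMSEQ)
  have [measurable]: "ft f \<in> borel_measurable borel"
    using f(2) by (intro borel_measurable_ft borel_measurable_sq_int)
  let ?F = "\<lambda>n. truncate (real n) (ft f)"
  obtain B where B: "\<And>w. cmod (ft f w) \<le> B" using norm_ft_le by blast
  show sq: "sq_int (?F n)" for n
  proof (rule sq_int_boundI[of _ "\<lambda>w. B\<^sup>2 * indicator {-real n..real n} w"])
    show "integrable lborel (\<lambda>w. B\<^sup>2 * indicator {-real n..real n} w)"
      by (intro integrable_mult_right integrable_real_indicator) (simp_all add: emeasure_lborel_Icc_eq)
    show "(cmod (truncate (real n) (ft f) w))\<^sup>2 \<le> B\<^sup>2 * indicator {-real n..real n} w" for w
      using B[of w] by (auto simp: truncate_def split: split_indicator intro!: power_mono)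
  qed (simp add: truncate_def[abs_def])
  show "l2norm (?F n) \<le> sqrt (2 * pi) * l2norm f" for n
  proof (rule power2_le_imp_le)
    interpret band_kernel "{-real n..real n}" "real n" "band_pass {-real n..real n}"
      by (rule band_kernel_Icc) simp
    let ?k = "band_pass {-real n..real n}"
    have "(l2norm (?F n))\<^sup>2 = (LINT w|lborel. indicator {-real n..real n} w * (cmod (ft f w))\<^sup>2)"
      unfolding l2norm_power2
      by (intro Bochner_Integration.integral_cong refl) (simp add: truncate_def split: split_indicator)
    also have "\<dots> = 2 * pi * (l2norm (conv ?k f))\<^sup>2"
      by (simp add: l2norm_conv_kernel_L1[OF f(1)])
    also have "\<dots> \<le> 2 * pi * (l2norm f)\<^sup>2"
      by (intro mult_left_mono power_mono l2norm_conv_kernel_le f) auto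
    finally show "(l2norm (?F n))\<^sup>2 \<le> (sqrt (2 * pi) * l2norm f)\<^sup>2"
      by (simp add: power_mult_distrib)
  qed simp
  show "(\<lambda>n. ?F n w) \<longlonglongrightarrow> ft f w" for w
  proof (rule tendsto_eventually)
    obtain m where "\<bar>w\<bar> \<le> real m" using real_arch_simple by blast
    then show "\<forall>\<^sub>F n in sequentially. ?F n w = ft f w"
      unfolding eventually_sequentially
      by (intro exI[of _ m]) (auto simp: truncate_def abs_le_iff)
  qed
qed

text \<open>Both sides of the identity for truncations converge: the left because filtering is a
  contraction, the right because restricting spectra to the band is one too.\<close>

lemma (in band_kernel) l2norm_conv_kernel_is_FT:
  assumes f: "sq_int f" and Q: "is_FT f Q"
  shows "(l2norm (conv k f))\<^sup>2 = 1 / (2 * pi) * (LINT w:A|lborel. (cmod (Q w))\<^sup>2)"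
proof -
  let ?F = "\<lambda>n. ft (truncate (real n) f)"
  let ?I = "\<lambda>g w. indicator A w * g w"
  have Qsq: "sq_int Q" using Q by (simp add: is_FT_def)
  \<comment> \<open>Gives the limit in \<open>is_FT\<close> its content: for a difference that is
    not square integrable, \<open>L2dist2\<close> would be 0 by default.\<close>
  have Fsq: "sq_int (?F n)" for n
    by (intro sq_int_ft integrable_truncate sq_int_truncate f)
  have "set_lebesgue_integral lborel {-R..R} (\<lambda>t. f t * exp (- \<i> * complex_of_real (w * t)))
      = ft (truncate R f) w" for R w
    unfolding set_lebesgue_integral_def ft_def
    by (intro Bochner_Integration.integral_cong refl)
       (simp add: truncate_def cis_conv_exp split: split_indicator)
  then have "((\<lambda>R. (l2norm (\<lambda>w. Q w - ft (truncate R f) w))\<^sup>2) \<longlongrightarrow> 0) at_top"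
    using Q unfolding is_FT_def L2dist2_eq by simp
  then have "(\<lambda>n. (l2norm (\<lambda>w. Q w - ?F n w))\<^sup>2) \<longlonglongrightarrow> 0"
    by (rule filterlim_compose[OF _ filterlim_real_sequentially])
  from tendsto_real_sqrt[OF this]
  have lim: "(\<lambda>n. l2norm (\<lambda>w. Q w - ?F n w)) \<longlonglongrightarrow> 0" by simp
  have "(\<lambda>n. l2norm (\<lambda>w. ?I (?F n) w - ?I Q w)) \<longlonglongrightarrow> 0"
  proof (rule Lim_null_comparison[OF _ lim], rule always_eventually, rule allI)
    fix n
    have "l2norm (\<lambda>w. ?I (?F n) w - ?I Q w) = l2norm (\<lambda>w. ?I (\<lambda>w. Q w - ?F n w) w)"
      by (subst l2norm_minus_commute) (simp add: algebra_simps)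
    then show "norm (l2norm (\<lambda>w. ?I (?F n) w - ?I Q w)) \<le> l2norm (\<lambda>w. Q w - ?F n w)"
      using sq_int_indicator_mult(2)[OF sq_int_diff[OF Qsq Fsq] band_measurable] by simp
  qed
  then have "(\<lambda>n. l2norm (?I (?F n))) \<longlonglongrightarrow> l2norm (?I Q)"
    by (intro tendsto_l2norm) (simp_all add: sq_int_indicator_mult band_measurable Fsq Qsq)
  then have 1: "(\<lambda>n. 1 / (2 * pi) * (l2norm (?I (?F n)))\<^sup>2) \<longlonglongrightarrow> 1 / (2 * pi) * (l2norm (?I Q))\<^sup>2"
    by (intro tendsto_intros)
  have I: "(l2norm (?I g))\<^sup>2 = (LINT w|lborel. indicator A w * (cmod (g w))\<^sup>2)" for g
    unfolding l2norm_power2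
    by (intro Bochner_Integration.integral_cong refl) (simp split: split_indicator)
  have "(\<lambda>n. (l2norm (conv k (truncate (real n) f)))\<^sup>2) \<longlonglongrightarrow> (l2norm (conv k f))\<^sup>2"
    by (intro tendsto_power l2norm_conv_kernel_tendsto l2norm_truncate_tendsto sq_int_truncate f)
  then have 2: "(\<lambda>n. 1 / (2 * pi) * (l2norm (?I (?F n)))\<^sup>2) \<longlonglongrightarrow> (l2norm (conv k f))\<^sup>2"
    unfolding I l2norm_conv_kernel_L1[OF integrable_truncate[OF f]] .
  show ?thesis
    using LIMSEQ_unique[OF 2 1] by (simp add: I set_lebesgue_integral_def)
qed

section \<open>The filter with several bands\<close>

lemma conv_sum_sum:
  assumes "\<And>i. i \<in> I \<Longrightarrow> sq_int (f i)" "\<And>j. j \<in> J \<Longrightarrow> sq_int (g j)"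
  shows "conv (\<lambda>t. \<Sum>i\<in>I. f i t) (\<lambda>t. \<Sum>j\<in>J. g j t) t = (\<Sum>i\<in>I. \<Sum>j\<in>J. conv (f i) (g j) t)"
proof -
  have "integrable lborel (\<lambda>s. f i s * g j (t - s))" if "i \<in> I" "j \<in> J" for i j
    using assms that by (intro sq_int_integrable_mult sq_int_reflect)
  then show ?thesis
    by (simp add: conv_def sum_product Bochner_Integration.integral_sum)
qed

lemma sq_int_sum:
  "(\<And>i. i \<in> I \<Longrightarrow> sq_int (f i)) \<Longrightarrow> sq_int (\<lambda>t. \<Sum>i\<in>I. f i t)"
proof (induction I rule: infinite_finite_induct)
  case (insert x F)
  then show ?case by (simp add: sq_int_add)
qed (auto simp: sq_int_def)

text \<open>Translating a band by \<open>c\<close> modulates its kernel by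
  \<open>cis (c * t)\<close>. This identifies the summands of \<open>filt_h\<close> as interval
  kernels.\<close>

lemma band_pass_centered:
  assumes "0 \<le> W"
  shows "band_pass {c - W / 2..c + W / 2} t
    = W / (2 * pi) * exp (\<i> * complex_of_real (c * t)) * Defs.sinc (W / (2 * pi) * t)"
proof -
  have "(LINT w|lborel. indicator {c - W / 2..c + W / 2} w * cis (w * t))
      = (LINT w|lborel. indicator {c - W / 2..c + W / 2} (c + w) * cis ((c + w) * t))"
    using lborel_integral_real_affine[of 1 "\<lambda>w. indicator {c - W / 2..c + W / 2} w * cis (w * t)" c] by simp
  also have "\<dots> = (LINT w|lborel. cis (c * t) * (indicator {- (W / 2)..W / 2} w * cis (w * t)))"
    by (intro Bochner_Integration.integral_cong refl)
       (simp add: distrib_right cis_mult[symmetric] split: split_indicator)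
  finally have "band_pass {c - W / 2..c + W / 2} t = cis (c * t) * band_pass {- (W / 2)..W / 2} t"
    by (simp add: band_pass_def)
  also have "band_pass {- (W / 2)..W / 2} t = W / 2 / pi * Sinc_Integral.sinc (W / 2 * t)"
    using assms by (intro band_pass_symmetric) simp
  also have "Sinc_Integral.sinc (W / 2 * t) = Defs.sinc (W / (2 * pi) * t)"
    by (simp add: Defs.sinc_def)
  finally show ?thesis by (simp add: cis_conv_exp)
qed

text \<open>Disjointness is used twice: the indicators of the bands add up to that of the union, and
  the cross terms of \<open>h * h\<close> vanish. The sum serves as a crude bound on all band edges
  that also covers \<open>N = 0\<close>.\<close>

lemma band_kernel_filt_h:
  assumes W: "\<And>n. n \<in> {1..N} \<Longrightarrow> W n > 0"
    and disj: "\<And>n m. n \<in> {1..N} \<Longrightarrow> m \<in> {1..N} \<Longrightarrow> n \<noteq> m \<Longrightarrow>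
                 {w. \<bar>w - wc n\<bar> \<le> W n / 2} \<inter> {w. \<bar>w - wc m\<bar> \<le> W m / 2} = {}"
  shows "band_kernel (band N wc W) (\<Sum>n\<in>{1..N}. \<bar>wc n\<bar> + W n / 2) (filt_h N wc W)"
proof -
  let ?I = "\<lambda>n. {wc n - W n / 2..wc n + W n / 2}"
  have Icc: "{w. \<bar>w - wc n\<bar> \<le> W n / 2} = ?I n" for n
    by (simp only: set_eq_iff abs_diff_le_iff mem_Collect_eq atLeastAtMost_iff simp_thms)
  have W0: "0 \<le> W n" if "n \<in> {1..N}" for n using W[OF that] by simp
  have le: "wc n - W n / 2 \<le> wc n + W n / 2" if "n \<in> {1..N}" for n using W0[OF that] by simp
  have band: "band N wc W = (\<Union>n\<in>{1..N}. ?I n)" by (simp only: band_def Icc)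
  have h: "filt_h N wc W = (\<lambda>t. \<Sum>n\<in>{1..N}. band_pass (?I n) t)"
    by (rule ext) (auto simp: filt_h_def band_pass_centered W0 intro!: sum.cong)
  have sq: "sq_int (band_pass (?I n))" if "n \<in> {1..N}" for n
    by (rule sq_int_band_pass_Icc[OF le[OF that]])
  have ind: "indicator (band N wc W) w = (\<Sum>n\<in>{1..N}. indicator (?I n) w :: complex)" for w
    unfolding band
    by (rule indicator_UN_disjoint) (simp, use disj[unfolded Icc] in \<open>unfold disjoint_family_on_def, blast\<close>)
  show ?thesis
  proof
    show "band N wc W \<in> sets borel" by (simp add: band)
    show "0 \<le> (\<Sum>n\<in>{1..N}. \<bar>wc n\<bar> + W n / 2)"
      by (intro sum_nonneg add_nonneg_nonneg) (use W0 in auto)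
    show "\<bar>w\<bar> \<le> (\<Sum>n\<in>{1..N}. \<bar>wc n\<bar> + W n / 2)" if "w \<in> band N wc W" for w
    proof -
      obtain n where n: "n \<in> {1..N}" "\<bar>w - wc n\<bar> \<le> W n / 2"
        using \<open>w \<in> band N wc W\<close> unfolding band_def by blast
      then have "\<bar>w\<bar> \<le> \<bar>wc n\<bar> + W n / 2" by linarith
      also have "\<dots> \<le> (\<Sum>n\<in>{1..N}. \<bar>wc n\<bar> + W n / 2)"
        by (rule member_le_sum[OF n(1)]) (use W0 in \<open>auto intro!: add_nonneg_nonneg\<close>)
      finally show ?thesis .
    qed
    show "filt_h N wc W t = 1 / (2 * pi) * (LINT w|lborel. indicator (band N wc W) w * cis (w * t))" for t
    proof -
      have i: "integrable lborel (\<lambda>w. indicator (?I n) w * cis (w * t))" for n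
        using integrable_mult_cis[OF integrable_indicator_Icc, of "wc n - W n / 2" "wc n + W n / 2" t]
        by (simp only: mult.commute[of t])
      have "(LINT w|lborel. indicator (band N wc W) w * cis (w * t))
          = (\<Sum>n\<in>{1..N}. LINT w|lborel. indicator (?I n) w * cis (w * t))"
        unfolding ind sum_distrib_right by (rule Bochner_Integration.integral_sum[OF i])
      then show ?thesis
        by (simp only: h band_pass_def sum_distrib_left)
    qed
    show "sq_int (filt_h N wc W)" unfolding h by (rule sq_int_sum[OF sq])
    show "conv (filt_h N wc W) (filt_h N wc W) t = filt_h N wc W t" for t
    proof -
      have "conv (filt_h N wc W) (filt_h N wc W) t
          = (\<Sum>n\<in>{1..N}. \<Sum>m\<in>{1..N}. conv (band_pass (?I n)) (band_pass (?I m)) t)"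
        unfolding h by (rule conv_sum_sum[OF sq sq])
      also have "\<dots> = (\<Sum>n\<in>{1..N}. \<Sum>m\<in>{1..N}. if m = n then band_pass (?I n) t else 0)"
      proof (intro sum.cong refl)
        fix n m assume nm: "n \<in> {1..N}" "m \<in> {1..N}"
        have "conv (band_pass (?I n)) (band_pass (?I m)) t = band_pass (?I n \<inter> ?I m) t"
          by (rule conv_band_pass_Icc[OF le le]; fact)
        moreover have "?I n \<inter> ?I m = {}" if "m \<noteq> n"
          using disj[OF nm] that unfolding Icc by blast
        ultimately show "conv (band_pass (?I n)) (band_pass (?I m)) t = (if m = n then band_pass (?I n) t else 0)"
          by (simp add: band_pass_def)
      qed
      also have "\<dots> = filt_h N wc W t" by (simp add: h)
      finally show ?thesis .
    qed
  qed
qed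

section \<open>Integration by parts and the derivative of the energy\<close>

text \<open>Averaging the translates of \<open>v'\<close> over shifts in \<open>[0, 1]\<close> turns
  the integral into that of \<open>v (t + 1) - v t\<close>, which is 0 by translation invariance. No
  decay of \<open>v\<close> at infinity has to be established.\<close>

lemma integral_derivative_eq_0:
  fixes v v' :: "real \<Rightarrow> real"
  assumes d: "\<And>t. (v has_real_derivative v' t) (at t)"
    and v: "integrable lborel v" and v': "integrable lborel v'"
  shows "(LINT t|lborel. v' t) = 0"
proof -
  have [measurable]: "v' \<in> borel_measurable borel" using v' by auto
  have iv': "integrable lborel (\<lambda>t. v' (t + s))" for s
    using lborel_integrable_real_affine[OF v', of 1 s] by (simp add: add.commute)
  have shift: "(LINT t|lborel. g (t + s)) = (LINT t|lborel. g t)" for g :: "real \<Rightarrow> real" and s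
    using lborel_integral_real_affine[of 1 g s] by (simp add: add.commute)
  have i: "integrable (lborel \<Otimes>\<^sub>M lborel) (\<lambda>(s, t). indicator {0..1} s * v' (t + s))"
  proof (rule lborel_pair.Fubini_integrable)
    show "integrable lborel (\<lambda>s. LINT t|lborel. norm (case (s, t) of (s, t) \<Rightarrow> indicator {0..1} s * v' (t + s)))"
      using shift[of "\<lambda>t. \<bar>v' t\<bar>"] by (simp add: abs_mult)
    show "AE s in lborel. integrable lborel (\<lambda>t. case (s, t) of (s, t) \<Rightarrow> indicator {0..1} s * v' (t + s))"
      using iv' by simp
  qed measurable
  have FTC: "(LINT s|lborel. indicator {0..1} s * v' (t + s)) = v (t + 1) - v t" for t
  proof -
    \<comment> \<open>Since \<open>v'\<close> may be discontinuous, the fundamental theorem is taken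
      for the gauge integral, which agrees with the Lebesgue integral because \<open>v'\<close> is
      integrable.\<close>
    have "((\<lambda>s. v' (t + s)) has_integral v (t + 1) - v (t + 0)) {0..1}"
    proof (rule fundamental_theorem_of_calculus)
      fix s :: real
      have "((\<lambda>s. t + s) has_real_derivative 1) (at s)" by (auto intro!: derivative_eq_intros)
      from DERIV_chain2[OF d this]
      have "((\<lambda>s. v (t + s)) has_vector_derivative v' (t + s)) (at s)"
        by (simp add: has_real_derivative_iff_has_vector_derivative)
      then show "((\<lambda>s. v (t + s)) has_vector_derivative v' (t + s)) (at s within {0..1})"
        by (rule has_vector_derivative_at_within)
    qed simp
    moreover have "set_integrable lborel {0..1} (\<lambda>s. v' (t + s))"
      unfolding set_integrable_def using iv'[of t]
      by (intro integrable_mult_indicator) (auto simp: add.commute)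
    note set_borel_integral_eq_integral(2)[OF this]
    ultimately show ?thesis
      by (simp add: set_lebesgue_integral_def integral_unique)
  qed
  have "(LINT t|lborel. v' t) = (LINT s|lborel. indicator {0..1::real} s * (LINT t|lborel. v' t))"
    by simp
  also have "\<dots> = (LINT s|lborel. LINT t|lborel. indicator {0..1} s * v' (t + s))"
    by (simp add: shift)
  also have "\<dots> = (LINT t|lborel. LINT s|lborel. indicator {0..1} s * v' (t + s))"
    by (rule lborel_pair.Fubini_integral[OF i, symmetric])
  also have "\<dots> = (LINT t|lborel. v (t + 1) - v t)" by (simp add: FTC)
  also have "\<dots> = (LINT t|lborel. v (t + 1)) - (LINT t|lborel. v t)"
    using lborel_integrable_real_affine[OF v, of 1 1] v
    by (intro Bochner_Integration.integral_diff) (auto simp: add.commute)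
  also have "\<dots> = 0" by (simp add: shift)
  finally show ?thesis .
qed

text \<open>The derivative of \<open>f' * cnj f\<close> is \<open>|f'|^2 + f'' * cnj f\<close>, and
  the first term is real, so \<open>Im (f'' * cnj f)\<close> is the derivative of an integrable
  function.\<close>

lemma Im_l2inner_second_derivative:
  assumes sq: "sq_int f" "sq_int f'" "sq_int f''"
    and f': "\<And>t. (f has_vector_derivative f' t) (at t)"
    and f'': "\<And>t. (f' has_vector_derivative f'' t) (at t)"
  shows "Im (l2inner f'' f) = 0"
proof -
  have "(LINT t|lborel. Im (f'' t * cnj (f t))) = 0"
  proof (rule integral_derivative_eq_0)
    show "integrable lborel (\<lambda>t. Im (f' t * cnj (f t)))" "integrable lborel (\<lambda>t. Im (f'' t * cnj (f t)))"
      by (intro integrable_Im l2inner_integrable sq)+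
    fix t
    have "((\<lambda>t. f' t * cnj (f t)) has_vector_derivative f' t * cnj (f' t) + f'' t * cnj (f t)) (at t)"
      by (intro has_vector_derivative_mult f'' has_vector_derivative_cnj f')
    from bounded_linear.has_vector_derivative[OF bounded_linear_Im this]
    show "((\<lambda>t. Im (f' t * cnj (f t))) has_real_derivative Im (f'' t * cnj (f t))) (at t)"
      by (simp add: has_real_derivative_iff_has_vector_derivative mult.commute)
  qed
  then show ?thesis
    unfolding l2inner_def by (subst integral_Im[symmetric, OF l2inner_integrable[OF sq(3,1)]])
qed

text \<open>With \<open>R d\<close> the difference quotient in distance, the quotient of energies
  equals \<open>2 * Re <R d, q y> + d * |R d|^2\<close> exactly. Mean-square convergence of
  \<open>R d\<close> keeps its norm bounded, so the second term disappears.\<close>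

lemma energy_has_derivative:
  assumes y: "y > 0" and sq: "\<And>x. x > 0 \<Longrightarrow> sq_int (q x)" and D: "sq_int D"
    and lim: "((\<lambda>d. L2dist2 (\<lambda>t. (q (y + d) t - q y t) / complex_of_real d) D) \<longlongrightarrow> 0) (at 0)"
  shows "((\<lambda>x. (l2norm (q x))\<^sup>2) has_real_derivative 2 * Re (l2inner D (q y))) (at y)"
  unfolding DERIV_def
proof (rule Lim_transform_eventually)
  define R where "R d t = (q (y + d) t - q y t) / complex_of_real d" for d t
  have "eventually (\<lambda>d. \<bar>d\<bar> < y) (at 0)"
    using y by (auto simp: eventually_at dist_real_def)
  \<comment> \<open>Square integrability is available only at positive distance, so \<open>d\<close>
    must be too small to reach 0.\<close>
  then have pos: "eventually (\<lambda>d. y + d > 0) (at 0)" by eventually_elim auto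
  have "sq_int (R d)" if "y + d > 0" for d
    using sq_int_cmult[OF sq_int_diff[OF sq[OF that] sq[OF y]], of "1 / d"] by (simp add: R_def[abs_def])
  then have Rsq: "eventually (\<lambda>d. sq_int (R d)) (at 0)" using pos by (auto elim: eventually_mono)
  have "((\<lambda>d. sqrt ((l2norm (\<lambda>t. R d t - D t))\<^sup>2)) \<longlongrightarrow> sqrt 0) (at 0)"
    using lim unfolding L2dist2_eq R_def by (rule tendsto_real_sqrt)
  then have RD: "((\<lambda>d. l2norm (\<lambda>t. R d t - D t)) \<longlongrightarrow> 0) (at 0)" by simp
  have "((\<lambda>d. 2 * Re (l2inner (R d) (q y)) + d * (l2norm (R d))\<^sup>2) \<longlongrightarrow>
      2 * Re (l2inner D (q y)) + 0 * (l2norm D)\<^sup>2) (at 0)"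
    by (intro tendsto_intros tendsto_l2inner_left[OF RD Rsq D sq[OF y]] tendsto_l2norm[OF RD Rsq D])
  then show "((\<lambda>d. 2 * Re (l2inner (R d) (q y)) + d * (l2norm (R d))\<^sup>2) \<longlongrightarrow>
      2 * Re (l2inner D (q y))) (at 0)" by simp
  have "eventually (\<lambda>d. d \<noteq> 0) (at (0::real))" by (simp add: eventually_at_filter)
  then show "eventually (\<lambda>d. 2 * Re (l2inner (R d) (q y)) + d * (l2norm (R d))\<^sup>2
      = ((l2norm (q (y + d)))\<^sup>2 - (l2norm (q y))\<^sup>2) / d) (at 0)"
    using Rsq
  proof eventually_elim
    case (elim d)
    have "q (y + d) = (\<lambda>t. d * R d t + q y t)" using elim(1) by (simp add: R_def)
    then have "(l2norm (q (y + d)))\<^sup>2 = (l2norm (\<lambda>t. d * R d t))\<^sup>2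
        + 2 * Re (l2inner (\<lambda>t. d * R d t) (q y)) + (l2norm (q y))\<^sup>2"
      using l2norm_power2_add[OF sq_int_cmult[OF elim(2), of d] sq[OF y]] by simp
    moreover have "l2inner (\<lambda>t. d * R d t) (q y) = d * l2inner (R d) (q y)"
      by (simp add: l2inner_def mult.assoc)
    ultimately show ?case
      using elim(1) by (simp add: l2norm_cmult power_mult_distrib field_simps power2_eq_square)
  qed
qed

subsection \<open>Energy decay\<close>

theorem theorem2:
  fixes N :: nat and wc W :: "nat \<Rightarrow> real" and \<alpha>0 \<beta>2 \<gamma> qmax :: real
    and q qtt :: "real \<Rightarrow> real \<Rightarrow> complex" and qt :: "real \<Rightarrow> real \<Rightarrow> complex"
    and Q0 :: "real \<Rightarrow> complex" and z :: real
  defines "h \<equiv> filt_h N wc W"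
  assumes W_pos: "\<And>n. n \<in> {1..N} \<Longrightarrow> W n > 0"
    and disj: "\<And>n m. n \<in> {1..N} \<Longrightarrow> m \<in> {1..N} \<Longrightarrow> n \<noteq> m \<Longrightarrow>
                 {w. \<bar>w - wc n\<bar> \<le> W n / 2} \<inter> {w. \<bar>w - wc m\<bar> \<le> W m / 2} = {}"
    and alpha0: "\<alpha>0 \<ge> 0"
    and L2: "\<And>y. y \<ge> 0 \<Longrightarrow> sq_int (q y)"
    and bounded: "\<And>y t. y \<ge> 0 \<Longrightarrow> cmod (q y t) \<le> qmax"
    and dt1: "\<And>y t. y > 0 \<Longrightarrow> ((\<lambda>s. q y s) has_vector_derivative qt y t) (at t)"
    and dt2: "\<And>y t. y > 0 \<Longrightarrow> ((\<lambda>s. qt y s) has_vector_derivative qtt y t) (at t)"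
    and bandlim: "\<And>y t. y > 0 \<Longrightarrow> q y t = conv h (q y) t"
    and propag: "\<And>y. y > 0 \<Longrightarrow>
       ((\<lambda>d. L2dist2 (\<lambda>t. (q (y + d) t - q y t) / complex_of_real d)
              (conv h (\<lambda>s. - complex_of_real (\<alpha>0 / 2) * q y s
                           - \<i> * complex_of_real (\<beta>2 / 2) * qtt y s
                           + \<i> * complex_of_real \<gamma> * complex_of_real ((cmod (q y s))\<^sup>2) * q y s)))
        \<longlongrightarrow> 0) (at 0)"
    and init: "((\<lambda>y. L2dist2 (conv h (q y)) (conv h (q 0))) \<longlongrightarrow> 0) (at_right 0)"
    and FT0: "is_FT (q 0) Q0"
    and zpos: "z > 0"
  shows "(LINT t|lborel. (cmod (conv h (q z) t))\<^sup>2)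
           = (1 / (2 * pi) * (LINT w:band N wc W|lborel. (cmod (Q0 w))\<^sup>2)) * exp (- \<alpha>0 * z)"
proof -
  \<comment> \<open>The unfiltered energy: it agrees with the filtered one at positive distance, but
    possibly not at 0.\<close>
  define E where "E y = (l2norm (q y))\<^sup>2" for y
  interpret band_kernel "band N wc W" "\<Sum>n\<in>{1..N}. \<bar>wc n\<bar> + W n / 2" h
    unfolding h_def by (rule band_kernel_filt_h[OF W_pos disj])
  have sq: "sq_int (q y)" if "y > 0" for y using L2 that by simp
  have bl: "conv h (q y) = q y" if "y > 0" for y using bandlim[OF that] by (simp add: fun_eq_iff)
  have E': "(E has_real_derivative - \<alpha>0 * E y) (at y)" if y: "y > 0" for y
  proof -
    define g where "g s = - complex_of_real (\<alpha>0 / 2) * q y s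
                           - \<i> * complex_of_real (\<beta>2 / 2) * qtt y s
                           + \<i> * complex_of_real \<gamma> * complex_of_real ((cmod (q y s))\<^sup>2) * q y s" for s
    note sqt = sq_int_derivatives_band_limited[OF sq[OF y] bl[OF y] dt1[OF y] dt2[OF y]]
    have [measurable]: "q y \<in> borel_measurable borel"
      using sq[OF y] by (rule borel_measurable_sq_int)
    \<comment> \<open>The amplitude bound enters here: \<open>|q|^6\<close> is at most
      \<open>qmax^4 * |q|^2\<close>.\<close>
    have cubic: "sq_int (\<lambda>s. complex_of_real ((cmod (q y s))\<^sup>2) * q y s)"
    proof (rule sq_int_boundI)
      show "integrable lborel (\<lambda>s. (qmax\<^sup>2)\<^sup>2 * (cmod (q y s))\<^sup>2)"
        using sq[OF y] by (simp add: sq_int_def)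
      show "(cmod (complex_of_real ((cmod (q y s))\<^sup>2) * q y s))\<^sup>2 \<le> (qmax\<^sup>2)\<^sup>2 * (cmod (q y s))\<^sup>2" for s
        unfolding norm_mult power_mult_distrib norm_of_real
        using bounded[of y s] y by (intro mult_right_mono power_mono) (auto intro: power_mono)
    qed measurable
    have gsq: "sq_int g"
      unfolding g_def mult.assoc
      by (intro sq_int_add sq_int_diff sq_int_cmult sq[OF y] sqt(2) cubic)
    have "Re (l2inner (conv h g) (q y)) = Re (l2inner g (q y))"
      by (simp only: conv_kernel_adjoint[OF gsq sq[OF y]] bl[OF y])
    also have "\<dots> = (LINT t|lborel. Re (g t * cnj (q y t)))"
      unfolding l2inner_def by (subst integral_Re[OF l2inner_integrable[OF gsq sq[OF y]]]) (rule refl)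
    \<comment> \<open>The Kerr term contributes a purely imaginary multiple of \<open>|q|^4\<close>
      and drops out pointwise. The dispersive term leaves \<open>Im (qtt * cnj q)\<close>, which
      vanishes only after integration.\<close>
    also have "\<dots> = (LINT t|lborel. - (\<alpha>0 / 2) * (cmod (q y t))\<^sup>2 + \<beta>2 / 2 * Im (qtt y t * cnj (q y t)))"
      by (intro Bochner_Integration.integral_cong refl)
         (simp add: g_def cmod_power2, simp add: power2_eq_square algebra_simps)
    also have "\<dots> = - (\<alpha>0 / 2) * (LINT t|lborel. (cmod (q y t))\<^sup>2)
        + \<beta>2 / 2 * (LINT t|lborel. Im (qtt y t * cnj (q y t)))"
      using sq[OF y] integrable_Im[OF l2inner_integrable[OF sqt(2) sq[OF y]]]
      unfolding sq_int_def
      by (subst Bochner_Integration.integral_add) (auto simp del: times_complex.sel)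
    also have "(LINT t|lborel. Im (qtt y t * cnj (q y t))) = Im (l2inner (qtt y) (q y))"
      unfolding l2inner_def by (rule integral_Im[OF l2inner_integrable[OF sqt(2) sq[OF y]]])
    also have "\<dots> = 0"
      by (rule Im_l2inner_second_derivative[OF sq[OF y] sqt dt1[OF y] dt2[OF y]])
    finally have "2 * Re (l2inner (conv h g) (q y)) = - \<alpha>0 * E y"
      by (simp add: E_def l2norm_power2)
    with energy_has_derivative[OF y sq sq_int_conv_kernel[OF gsq] propag[OF y, folded g_def]]
    show ?thesis by (simp add: E_def[abs_def])
  qed
  \<comment> \<open>Integrating factor on the open half-line; the constant it yields must then be
    found from the limit at 0.\<close>
  have "((\<lambda>y. E y * exp (\<alpha>0 * y)) has_field_derivative 0) (at y within {0<..})" if "y \<in> {0<..}" for y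
  proof -
    have "((\<lambda>y. E y * exp (\<alpha>0 * y)) has_field_derivative
        - \<alpha>0 * E y * exp (\<alpha>0 * y) + exp (\<alpha>0 * y) * \<alpha>0 * E y) (at y)"
      using that by (auto intro!: derivative_eq_intros E')
    then show ?thesis by (auto simp: mult_ac intro: has_field_derivative_at_within)
  qed
  from has_field_derivative_zero_constant[OF convex_real_interval(3) this]
  obtain c where c: "\<And>y. y > 0 \<Longrightarrow> E y * exp (\<alpha>0 * y) = c" by auto
  let ?E0 = "(l2norm (conv h (q 0)))\<^sup>2"
  have "((\<lambda>y. sqrt (L2dist2 (conv h (q y)) (conv h (q 0)))) \<longlongrightarrow> sqrt 0) (at_right 0)"
    by (rule tendsto_real_sqrt[OF init])
  then have lim: "((\<lambda>y. l2norm (\<lambda>t. conv h (q y) t - conv h (q 0) t)) \<longlongrightarrow> 0) (at_right 0)"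
    by (simp add: L2dist2_eq)
  have pos: "eventually (\<lambda>y::real. y > 0) (at_right 0)" by (rule eventually_at_right_less)
  \<comment> \<open>The limit is taken for the filtered energy, since \<open>init\<close> controls
    \<open>conv h (q y)\<close> and \<open>q 0\<close> may lie partly outside the band.\<close>
  have "((\<lambda>y. (l2norm (conv h (q y)))\<^sup>2 * exp (\<alpha>0 * y)) \<longlongrightarrow> ?E0 * exp (\<alpha>0 * 0)) (at_right 0)"
    using pos
    by (intro tendsto_intros tendsto_l2norm[OF lim])
       (auto intro!: sq_int_conv_kernel L2 elim!: eventually_mono)
  moreover have "eventually (\<lambda>y. (l2norm (conv h (q y)))\<^sup>2 * exp (\<alpha>0 * y) = c) (at_right 0)"
    using pos by eventually_elim (use c in \<open>simp add: bl E_def\<close>)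
  ultimately have "((\<lambda>y::real. c) \<longlongrightarrow> ?E0 * exp (\<alpha>0 * 0)) (at_right 0)"
    by (rule Lim_transform_eventually)
  then have "c = ?E0" by (simp add: tendsto_const_iff)
  then have "E z = ?E0 * exp (- \<alpha>0 * z)"
    using c[OF zpos] by (simp add: exp_minus field_simps)
  moreover have "(LINT t|lborel. (cmod (conv h (q z) t))\<^sup>2) = E z"
    by (simp add: E_def l2norm_power2 bl[OF zpos])
  ultimately show ?thesis
    using l2norm_conv_kernel_is_FT[OF L2[of 0] FT0] by simp
qed

end
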